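(* Let $(\Omega,\Sigma,\mathbb{P})$ be a Gaussian probability space over a separable real Hilbert space $H$, with $J$ and $X\in L^2(\Omega,\mathbb{P};H_-)$ as defined in the context. Then $\mathbb{P}$ is a $(1,X)$-KMS state in the following sense: for all $F,G\in\mathscr{C}^\infty_{c,cyl}(\Omega)$, $$\mathbb{E}\big(\{F,G\}\big)=\mathbb{E}\big(\langle\nabla F,X\rangle\,G\big).$$
   Context: A Gaussian probability space is a complete probability space $(\Omega,\Sigma,\mathbb{P})$ with a family of centered Gaussian random variables $W(f):\Omega\to\mathbb{R}$ indexed by a separable (infinite-dimensional) real Hilbert space $H$ such that $\mathbb{E}(W(f)W(g))=\langle f,g\rangle$ for all $f,g\in H$ (so $f\mapsto W(f)$ is a linear isometry into $L^2(\Omega,\mathbb{P})$). Let $\{e_j\}_{j\ge1}$ be an orthonormal basis of $H$ and let $J:H\to H$ be the bounded linear operator with $Je_{2j-1}=e_{2j}$, $Je_{2j}=-e_{2j-1}$ for all $j\ge1$. Let $(\alpha_j)_{j\ge1}$ be positive reals with $\sum_j\alpha_j^{-1}<\infty$. $H_+=\{u\in H:\sum_j\alpha_j\langle u,e_j\rangle^2<\infty\}$ is a Hilbert space with $\langle u,v\rangle_{H_+}=\sum_j\alpha_j\langle u,e_j\rangle\langle e_j,v\rangle$, and $H_-$ is the dual of $H_+$ with respect to the inner product of $H$, with norm $\|u\|_{H_-}=(\sum_j\alpha_j^{-1}\langle u,e_j\rangle^2)^{1/2}$. The vector field is $X=\sum_{j=1}^\infty W(e_j)\,Je_j$, the series converging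 in $L^2(\Omega,\mathbb{P};H_-)$. $\mathscr{C}^\infty_{c,cyl}(\Omega)$ is the set of $F=\varphi(W(e_1),\dots,W(e_n))$ with $n\in\mathbb{N}$ and $\varphi\in\mathscr{C}_c^\infty(\mathbb{R}^n)$ real-valued. The gradient is $\nabla F=\sum_{j=1}^n\partial_j\varphi(W(e_1),\dots,W(e_n))\,e_j$, and $\{F,G\}=\langle\nabla F,J\nabla G\rangle$. $\langle\nabla F,X\rangle$ is the $H_+$–$H_-$ duality pairing. *)

theory Defs
  imports "HOL-Probability.Probability"
begin

section \<open>Gaussian probability spaces\<close>

text \<open>Only the Dirac mass at 0 is degenerate; it must be allowed because of the zero vector of the
  Hilbert space.\<close>

definition centered_gaussian :: "'a measure \<Rightarrow> ('a \<Rightarrow> real) \<Rightarrow> bool" where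
  "centered_gaussian M Y \<longleftrightarrow>
     Y \<in> borel_measurable M \<and>
     ((AE \<omega> in M. Y \<omega> = 0) \<or>
      (\<exists>\<sigma>>0. distributed M lborel Y (\<lambda>x. ennreal (normal_density 0 \<sigma> x))))"

text \<open>The sort \<open>{real_inner, polish_space}\<close> describes the separable real Hilbert spaces.\<close>

locale gaussian_space = prob_space M + complete_measure M
  for M :: "'a measure" +
  fixes W :: "'h::{real_inner, polish_space} \<Rightarrow> 'a \<Rightarrow> real"
  assumes W_gaussian: "\<And>f. centered_gaussian M (W f)"
    and W_covariance: "\<And>f g. (\<integral>\<omega>. W f \<omega> * W g \<omega> \<partial>M) = f \<bullet> g"


section \<open>Orthonormal bases and the operator \<open>J\<close>\<close>

text \<open>All sequences are indexed by \<open>j \<ge> 1\<close>; the value at 0 is never used.\<close>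

definition orthonormal_basis :: "(nat \<Rightarrow> 'h::real_inner) \<Rightarrow> bool" where
  "orthonormal_basis e \<longleftrightarrow>
     (\<forall>i\<ge>1. \<forall>j\<ge>1. e i \<bullet> e j = (if i = j then 1 else 0)) \<and>
     closure (span (e ` {1..})) = UNIV"

definition symplectic_operator :: "(nat \<Rightarrow> 'h::real_inner) \<Rightarrow> ('h \<Rightarrow> 'h) \<Rightarrow> bool" where
  "symplectic_operator e J \<longleftrightarrow>
     bounded_linear J \<and>
     (\<forall>j\<ge>1. J (e (2 * j - 1)) = e (2 * j) \<and> J (e (2 * j)) = - e (2 * j - 1))"


section \<open>The weighted spaces \<open>H\<^sub>+\<close> and \<open>H\<^sub>-\<close>\<close>

definition admissible_weights :: "(nat \<Rightarrow> real) \<Rightarrow> bool" where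
  "admissible_weights \<alpha> \<longleftrightarrow> (\<forall>j\<ge>1. \<alpha> j > 0) \<and> (\<lambda>j. inverse (\<alpha> j)) summable_on {1..}"

definition Hplus :: "(nat \<Rightarrow> 'h::real_inner) \<Rightarrow> (nat \<Rightarrow> real) \<Rightarrow> 'h set" where
  "Hplus e \<alpha> = {u. (\<lambda>j. \<alpha> j * (u \<bullet> e j)\<^sup>2) summable_on {1..}}"

definition Hplus_inner :: "(nat \<Rightarrow> 'h::real_inner) \<Rightarrow> (nat \<Rightarrow> real) \<Rightarrow> 'h \<Rightarrow> 'h \<Rightarrow> real" where
  "Hplus_inner e \<alpha> u v = (\<Sum>\<^sub>\<infinity>j\<in>{1..}. \<alpha> j * (u \<bullet> e j) * (e j \<bullet> v))"

definition Hplus_norm :: "(nat \<Rightarrow> 'h::real_inner) \<Rightarrow> (nat \<Rightarrow> real) \<Rightarrow> 'h \<Rightarrow> real" where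
  "Hplus_norm e \<alpha> u = sqrt (Hplus_inner e \<alpha> u u)"

text \<open>\<open>H\<^sub>-\<close> is the space of bounded linear functionals on \<open>H\<^sub>+\<close>, extended by 0 outside \<open>H\<^sub>+\<close> so that a
  functional is determined by its values on \<open>H\<^sub>+\<close>. The pairing of \<open>v \<in> H\<^sub>+\<close> with \<open>l \<in> H\<^sub>-\<close> is \<open>l v\<close>.
  The space \<open>H\<close> embeds through its inner product, so \<open>l (e j)\<close> is what is
  written \<open>\<langle>l, e\<^sub>j\<rangle>\<close> for an element \<open>l\<close> of \<open>H\<^sub>-\<close>.\<close>

definition Hminus :: "(nat \<Rightarrow> 'h::real_inner) \<Rightarrow> (nat \<Rightarrow> real) \<Rightarrow> ('h \<Rightarrow> real) set" where
  "Hminus e \<alpha> =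
     {l. (\<forall>u\<in>Hplus e \<alpha>. \<forall>v\<in>Hplus e \<alpha>. l (u + v) = l u + l v) \<and>
         (\<forall>c. \<forall>u\<in>Hplus e \<alpha>. l (c *\<^sub>R u) = c * l u) \<and>
         (\<exists>C. \<forall>u\<in>Hplus e \<alpha>. \<bar>l u\<bar> \<le> C * Hplus_norm e \<alpha> u) \<and>
         (\<forall>u. u \<notin> Hplus e \<alpha> \<longrightarrow> l u = 0)}"

definition Hminus_norm :: "(nat \<Rightarrow> 'h::real_inner) \<Rightarrow> (nat \<Rightarrow> real) \<Rightarrow> ('h \<Rightarrow> real) \<Rightarrow> real" where
  "Hminus_norm e \<alpha> l = sqrt (\<Sum>\<^sub>\<infinity>j\<in>{1..}. inverse (\<alpha> j) * (l (e j))\<^sup>2)"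

definition Hminus_embed ::
  "(nat \<Rightarrow> 'h::real_inner) \<Rightarrow> (nat \<Rightarrow> real) \<Rightarrow> 'h \<Rightarrow> ('h \<Rightarrow> real)" where
  "Hminus_embed e \<alpha> h = (\<lambda>v. if v \<in> Hplus e \<alpha> then h \<bullet> v else 0)"

text \<open>The Borel sigma-algebra of the normed space \<open>H\<^sub>-\<close>. As \<open>H\<^sub>-\<close> is separable, Borel measurability
  and strong (Bochner) measurability of \<open>H\<^sub>-\<close>-valued maps agree.\<close>

definition Hminus_borel ::
  "(nat \<Rightarrow> 'h::real_inner) \<Rightarrow> (nat \<Rightarrow> real) \<Rightarrow> ('h \<Rightarrow> real) measure" where
  "Hminus_borel e \<alpha> =
     sigma (Hminus e \<alpha>)
       {U. U \<subseteq> Hminus e \<alpha> \<and>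
           (\<forall>l\<in>U. \<exists>r>0. \<forall>k\<in>Hminus e \<alpha>. Hminus_norm e \<alpha> (\<lambda>v. k v - l v) < r \<longrightarrow> k \<in> U)}"

definition L2_Hminus ::
  "'a measure \<Rightarrow> (nat \<Rightarrow> 'h::real_inner) \<Rightarrow> (nat \<Rightarrow> real) \<Rightarrow> ('a \<Rightarrow> 'h \<Rightarrow> real) set" where
  "L2_Hminus M e \<alpha> =
     {Y \<in> M \<rightarrow>\<^sub>M Hminus_borel e \<alpha>. (\<integral>\<^sup>+\<omega>. ennreal ((Hminus_norm e \<alpha> (Y \<omega>))\<^sup>2) \<partial>M) < \<infinity>}"

text \<open>\<open>X = \<Sum>\<^sub>j W(e\<^sub>j) J e\<^sub>j\<close> as a series in \<open>L\<^sup>2(M; H\<^sub>-)\<close>: the predicate holds for exactly the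
  representatives \<open>X\<close> of the almost-everywhere class of its sum.\<close>

definition is_vector_field ::
  "'a measure \<Rightarrow> ('h::real_inner \<Rightarrow> 'a \<Rightarrow> real) \<Rightarrow> (nat \<Rightarrow> 'h) \<Rightarrow> (nat \<Rightarrow> real) \<Rightarrow> ('h \<Rightarrow> 'h)
    \<Rightarrow> ('a \<Rightarrow> 'h \<Rightarrow> real) \<Rightarrow> bool" where
  "is_vector_field M W e \<alpha> J X \<longleftrightarrow>
     X \<in> L2_Hminus M e \<alpha> \<and>
     (\<lambda>n. \<integral>\<^sup>+\<omega>. ennreal ((Hminus_norm e \<alpha>
        (\<lambda>v. X \<omega> v - Hminus_embed e \<alpha> (\<Sum>j=1..n. W (e j) \<omega> *\<^sub>R J (e j)) v))\<^sup>2) \<partial>M)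
       \<longlonglongrightarrow> 0"


section \<open>Smooth cylindrical functions\<close>

text \<open>A function on \<open>\<real>\<^sup>n\<close> is encoded as a function on real sequences that depends only on the
  coordinates \<open>1, \<dots>, n\<close>. For such functions, continuity in the product topology on
  \<open>nat \<Rightarrow> real\<close> is continuity on \<open>\<real>\<^sup>n\<close>.\<close>

definition partial_deriv :: "nat \<Rightarrow> ((nat \<Rightarrow> real) \<Rightarrow> real) \<Rightarrow> (nat \<Rightarrow> real) \<Rightarrow> real" where
  "partial_deriv j \<phi> x = deriv (\<lambda>t. \<phi> (x(j := t))) (x j)"

text \<open>\<open>Ck n k \<phi>\<close>: all partial derivatives of \<open>\<phi>\<close> of order at most \<open>k\<close> in the first \<open>n\<close> variables
  exist and are continuous.\<close>

primrec Ck :: "nat \<Rightarrow> nat \<Rightarrow> ((nat \<Rightarrow> real) \<Rightarrow> real) \<Rightarrow> bool" where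
  "Ck n 0 \<phi> \<longleftrightarrow> continuous_on UNIV \<phi>"
| "Ck n (Suc k) \<phi> \<longleftrightarrow>
     continuous_on UNIV \<phi> \<and>
     (\<forall>j\<in>{1..n}. (\<forall>x. (\<lambda>t. \<phi> (x(j := t))) differentiable (at (x j))) \<and>
                 Ck n k (partial_deriv j \<phi>))"

definition Cc_infinity :: "nat \<Rightarrow> ((nat \<Rightarrow> real) \<Rightarrow> real) set" where
  "Cc_infinity n =
     {\<phi>. (\<forall>x y. (\<forall>j\<in>{1..n}. x j = y j) \<longrightarrow> \<phi> x = \<phi> y) \<and>
         (\<forall>k. Ck n k \<phi>) \<and>
         (\<exists>R. \<forall>x. \<phi> x \<noteq> 0 \<longrightarrow> (\<forall>j\<in>{1..n}. \<bar>x j\<bar> \<le> R))}"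

definition cyl_rep ::
  "'a measure \<Rightarrow> ('h::real_inner \<Rightarrow> 'a \<Rightarrow> real) \<Rightarrow> (nat \<Rightarrow> 'h)
    \<Rightarrow> nat \<Rightarrow> ((nat \<Rightarrow> real) \<Rightarrow> real) \<Rightarrow> ('a \<Rightarrow> real) \<Rightarrow> bool" where
  "cyl_rep M W e n \<phi> F \<longleftrightarrow>
     \<phi> \<in> Cc_infinity n \<and> (\<forall>\<omega>\<in>space M. F \<omega> = \<phi> (\<lambda>j. W (e j) \<omega>))"

definition Cc_cyl ::
  "'a measure \<Rightarrow> ('h::real_inner \<Rightarrow> 'a \<Rightarrow> real) \<Rightarrow> (nat \<Rightarrow> 'h) \<Rightarrow> ('a \<Rightarrow> real) set" where
  "Cc_cyl M W e = {F. \<exists>n \<phi>. cyl_rep M W e n \<phi> F}"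

text \<open>\<open>DF\<close> is the gradient of \<open>F\<close> computed from some representation of \<open>F\<close>. Stating results for all such
  \<open>DF\<close> covers every representation and needs no prior proof that the gradient does not
  depend on it.\<close>

definition is_gradient ::
  "'a measure \<Rightarrow> ('h::real_inner \<Rightarrow> 'a \<Rightarrow> real) \<Rightarrow> (nat \<Rightarrow> 'h)
    \<Rightarrow> ('a \<Rightarrow> real) \<Rightarrow> ('a \<Rightarrow> 'h) \<Rightarrow> bool" where
  "is_gradient M W e F DF \<longleftrightarrow>
     (\<exists>n \<phi>. cyl_rep M W e n \<phi> F \<and>
        (\<forall>\<omega>\<in>space M. DF \<omega> = (\<Sum>j=1..n. partial_deriv j \<phi> (\<lambda>i. W (e i) \<omega>) *\<^sub>R e j)))"

text \<open>The bracket \<open>{F, G}\<close> in terms of the gradients of \<open>F\<close> and \<open>G\<close>.\<close>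

definition poisson_bracket ::
  "('h::real_inner \<Rightarrow> 'h) \<Rightarrow> ('a \<Rightarrow> 'h) \<Rightarrow> ('a \<Rightarrow> 'h) \<Rightarrow> 'a \<Rightarrow> real" where
  "poisson_bracket J DF DG \<omega> = DF \<omega> \<bullet> J (DG \<omega>)"

end

theory Submission
  imports Defs "HOL-Real_Asymp.Real_Asymp"
begin

text \<open>Let \<open>k'\<close> be the index paired with \<open>k\<close> by \<open>J\<close> and \<open>s\<^sub>k = \<plusminus>1\<close> the sign with \<open>J e\<^sub>k\<^sub>' = s\<^sub>k e\<^sub>k\<close>. Then
  \<open>\<langle>X, e\<^sub>k\<rangle> = s\<^sub>k W(e\<^sub>k\<^sub>')\<close> almost surely and \<open>{F, G} = \<Sum>\<^sub>k s\<^sub>k \<partial>\<^sub>kF \<partial>\<^sub>k\<^sub>'G\<close>. Since \<open>W\<close> is almost surely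
  linear, every linear combination of the \<open>W(e\<^sub>j)\<close> is Gaussian, hence the \<open>W(e\<^sub>j)\<close> are independent
  standard normal variables. Gaussian integration by parts turns \<open>E(\<partial>\<^sub>kF W(e\<^sub>k\<^sub>') G)\<close> into
  \<open>E(\<partial>\<^sub>k\<^sub>'\<partial>\<^sub>kF G) + E(\<partial>\<^sub>kF \<partial>\<^sub>k\<^sub>'G)\<close>. After multiplication by \<open>s\<^sub>k\<close> and summation the second
  derivatives cancel, because they are symmetric and \<open>s\<^sub>k\<^sub>' = - s\<^sub>k\<close>.\<close>

text \<open>Gaussian linear combinations yield a factorised joint characteristic function, and
  independence has to be drawn from that. Only uniqueness of characteristic functions on the real
  line is used: exponentials are replaced by indicators one variable at a time, and each replacement
  compares two laws on the line. The vector field is known only through its L^2 series in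
  \<open>H_-\<close>. Gradients of cylindrical functions are finite combinations of the
  \<open>e k\<close>, so the pairing sees finitely many coordinates \<open>X \<omega> (e k)\<close>,
  and each of these is controlled by one term of the \<open>H_-\<close> norm. Divergent infinite
  sums and integrals have value 0, so the summability and integrability behind a norm or an
  expectation are proved separately. The numbers of variables of \<open>F\<close> and
  \<open>G\<close> are unrelated, and the partner of an index \<open>k \<le> n\<close> can be
  \<open>n + 1\<close>. Integration by parts therefore works over all indices and relies on
  derivatives in absent coordinates being 0.\<close>

section \<open>Independence from characteristic functions\<close>

context prob_space
begin

text \<open>Tilting \<open>M\<close> by the positive density \<open>K + 1 + h\<close> does not change the characteristic function
  of \<open>Y\<close>, so by uniqueness it does not change the law of \<open>Y\<close>.\<close>

lemma uncorrelated_indicator_real: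
  fixes Y h :: "'a \<Rightarrow> real"
  assumes Y[measurable]: "Y \<in> borel_measurable M" and h[measurable]: "h \<in> borel_measurable M"
    and bound: "\<And>\<omega>. \<bar>h \<omega>\<bar> \<le> K"
    and eq: "\<And>t. (\<integral>\<omega>. complex_of_real (h \<omega>) * iexp (t * Y \<omega>) \<partial>M) =
      complex_of_real (\<integral>\<omega>. h \<omega> \<partial>M) * (\<integral>\<omega>. iexp (t * Y \<omega>) \<partial>M)"
    and S[measurable]: "S \<in> sets borel"
  shows "(\<integral>\<omega>. h \<omega> * indicator S (Y \<omega>) \<partial>M) = (\<integral>\<omega>. h \<omega> \<partial>M) * (\<integral>\<omega>. indicator S (Y \<omega>) \<partial>M)"
proof -
  \<comment> \<open>The 1 on top of the bound \<open>K\<close> makes \<open>p \<ge> 1\<close>, so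
    the total mass \<open>Z\<close> used for normalisation is at least 1.\<close>
  define p where "p \<omega> = K + 1 + h \<omega>" for \<omega>
  have p1: "p \<omega> \<ge> 1" for \<omega> using bound[of \<omega>] by (auto simp: p_def)
  have p[measurable]: "p \<in> borel_measurable M" unfolding p_def by measurable
  have ih: "integrable M h"
    by (rule integrable_const_bound[of _ K]) (auto simp: bound)
  have ip: "integrable M p" unfolding p_def using ih by auto
  define Z where "Z = (\<integral>\<omega>. p \<omega> \<partial>M)"
  have Zeq: "Z = K + 1 + (\<integral>\<omega>. h \<omega> \<partial>M)"
    unfolding Z_def p_def using ih by (simp add: prob_space)
  have Z1: "Z \<ge> 1"
    using integral_mono[of M "\<lambda>_. 1" p] ip p1 unfolding Z_def by (simp add: prob_space)
  define N where "N = density M (\<lambda>\<omega>. ennreal (p \<omega> / Z))"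
  have pZ0: "0 \<le> p \<omega> / Z" for \<omega> using p1[of \<omega>] Z1 by simp
  have "emeasure N (space N) = (\<integral>\<^sup>+\<omega>. ennreal (p \<omega> / Z) \<partial>M)"
    unfolding N_def by (subst emeasure_density) (auto intro!: nn_integral_cong)
  also have "\<dots> = ennreal (\<integral>\<omega>. p \<omega> / Z \<partial>M)"
    using ip pZ0 by (intro nn_integral_eq_integral) auto
  also have "(\<integral>\<omega>. p \<omega> / Z \<partial>M) = 1" using Z1 by (simp add: Z_def)
  finally interpret N: prob_space N by (intro prob_spaceI) simp
  have YN[measurable]: "Y \<in> borel_measurable N" unfolding N_def by simp
  have "distr N borel Y = distr M borel Y"
  proof (rule Levy_uniqueness)
    show "real_distribution (distr N borel Y)"
      by (intro real_distribution.intro N.prob_space_distr real_distribution_axioms.intro) auto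
    show "real_distribution (distr M borel Y)"
      by (intro real_distribution.intro prob_space_distr real_distribution_axioms.intro) auto
    show "char (distr N borel Y) = char (distr M borel Y)"
    proof
      fix t
      have i1: "integrable M (\<lambda>\<omega>. iexp (t * Y \<omega>))"
        by (rule integrable_const_bound[of _ 1]) auto
      have i2: "integrable M (\<lambda>\<omega>. complex_of_real (h \<omega>) * iexp (t * Y \<omega>))"
        by (rule integrable_const_bound[of _ K]) (auto simp: norm_mult bound)
      have "char (distr N borel Y) t = (\<integral>\<omega>. iexp (t * Y \<omega>) \<partial>N)"
        unfolding char_def by (simp add: integral_distr)
      also have "\<dots> = (\<integral>\<omega>. (p \<omega> / Z) *\<^sub>R iexp (t * Y \<omega>) \<partial>M)"
        unfolding N_def using pZ0 by (subst integral_density) auto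
      \<comment> \<open>The constant \<open>K + 1\<close> factors trivially and \<open>h\<close> by
        hypothesis, so \<open>p\<close> factors as well, with \<open>Z\<close> as the factor that
        the normalisation cancels.\<close>
      also have "\<dots> = (\<integral>\<omega>. ((K + 1) * iexp (t * Y \<omega>) + complex_of_real (h \<omega>) * iexp (t * Y \<omega>)) / Z \<partial>M)"
        by (intro Bochner_Integration.integral_cong refl) (simp add: p_def scaleR_conv_of_real field_simps)
      also have "\<dots> = ((K + 1) * (\<integral>\<omega>. iexp (t * Y \<omega>) \<partial>M) + complex_of_real (\<integral>\<omega>. h \<omega> \<partial>M) * (\<integral>\<omega>. iexp (t * Y \<omega>) \<partial>M)) / Z"
        unfolding eq[symmetric] using i1 i2 by simp
      also have "(K + 1) * (\<integral>\<omega>. iexp (t * Y \<omega>) \<partial>M) + complex_of_real (\<integral>\<omega>. h \<omega> \<partial>M) * (\<integral>\<omega>. iexp (t * Y \<omega>) \<partial>M)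
          = (\<integral>\<omega>. iexp (t * Y \<omega>) \<partial>M) * complex_of_real Z"
        unfolding Zeq by (simp add: algebra_simps)
      also have "(\<integral>\<omega>. iexp (t * Y \<omega>) \<partial>M) * complex_of_real Z / complex_of_real Z = (\<integral>\<omega>. iexp (t * Y \<omega>) \<partial>M)"
        using Z1 by simp
      also have "\<dots> = char (distr M borel Y) t"
        unfolding char_def by (simp add: integral_distr)
      finally show "char (distr N borel Y) t = char (distr M borel Y) t" .
    qed
  qed
  then have "(\<integral>y. indicator S y \<partial>distr N borel Y) = (\<integral>y. indicator S y \<partial>distr M borel Y :: real)"
    by simp
  then have *: "(\<integral>\<omega>. indicator S (Y \<omega>) \<partial>N) = (\<integral>\<omega>. indicator S (Y \<omega>) \<partial>M :: real)"
    by (simp only: integral_distr[OF YN borel_measurable_indicator[OF S]]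
      integral_distr[OF Y borel_measurable_indicator[OF S]])
  have i3: "integrable M (\<lambda>\<omega>. indicator S (Y \<omega>) :: real)"
    by (rule integrable_const_bound[of _ 1]) (auto simp: indicator_def)
  have i4: "integrable M (\<lambda>\<omega>. h \<omega> * indicator S (Y \<omega>) :: real)"
    using bound order_trans[OF abs_ge_zero bound]
    by (intro integrable_const_bound[of _ K]) (auto simp: indicator_def)
  \<comment> \<open>Equal laws give \<open>S\<close> equal mass. Written out under \<open>M\<close>
    and multiplied by \<open>Z\<close>, this is the claim plus a multiple \<open>K + 1\<close> of
    the mass of \<open>S\<close> on both sides.\<close>
  have "(\<integral>\<omega>. indicator S (Y \<omega>) \<partial>N) = (\<integral>\<omega>. (p \<omega> / Z) *\<^sub>R indicator S (Y \<omega>) \<partial>M :: real)"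
    unfolding N_def using pZ0 by (subst integral_density) auto
  also have "\<dots> = (\<integral>\<omega>. ((K + 1) * indicator S (Y \<omega>) + h \<omega> * indicator S (Y \<omega>)) / Z \<partial>M)"
    by (intro Bochner_Integration.integral_cong refl) (simp add: p_def field_simps)
  also have "\<dots> = ((K + 1) * (\<integral>\<omega>. indicator S (Y \<omega>) \<partial>M) + (\<integral>\<omega>. h \<omega> * indicator S (Y \<omega>) \<partial>M)) / Z"
    using i3 i4 by simp
  finally show ?thesis using * Z1 unfolding Zeq by (simp add: field_simps)
qed

text \<open>A density must be real, so the real case is applied to \<open>Re\<close> and
  \<open>Im\<close> of \<open>h\<close>. Their factorisation needs that of
  \<open>cnj (h \<omega>)\<close>, which is the conjugate of the hypothesis at frequency
  \<open>- t\<close>.\<close>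

lemma uncorrelated_indicator_complex:
  fixes Y :: "'a \<Rightarrow> real" and h :: "'a \<Rightarrow> complex"
  assumes Y[measurable]: "Y \<in> borel_measurable M" and h[measurable]: "h \<in> borel_measurable M"
    and bound: "\<And>\<omega>. norm (h \<omega>) \<le> K"
    and eq: "\<And>t. (\<integral>\<omega>. h \<omega> * iexp (t * Y \<omega>) \<partial>M) = (\<integral>\<omega>. h \<omega> \<partial>M) * (\<integral>\<omega>. iexp (t * Y \<omega>) \<partial>M)"
    and S[measurable]: "S \<in> sets borel"
  shows "(\<integral>\<omega>. h \<omega> * indicator S (Y \<omega>) \<partial>M) =
    (\<integral>\<omega>. h \<omega> \<partial>M) * complex_of_real (\<integral>\<omega>. indicator S (Y \<omega>) \<partial>M)"
proof -
  have ih: "integrable M h"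
    by (rule integrable_const_bound[of _ K]) (auto simp: bound)
  have i1: "integrable M (\<lambda>\<omega>. h \<omega> * iexp (t * Y \<omega>))" for t
    by (rule integrable_const_bound[of _ K]) (auto simp: norm_mult bound)
  have eqc: "(\<integral>\<omega>. cnj (h \<omega>) * iexp (t * Y \<omega>) \<partial>M) = cnj (\<integral>\<omega>. h \<omega> \<partial>M) * (\<integral>\<omega>. iexp (t * Y \<omega>) \<partial>M)" for t
  proof -
    have c: "cnj (iexp (- t * Y \<omega>)) = iexp (t * Y \<omega>)" for \<omega> by (simp add: exp_cnj)
    have "(\<integral>\<omega>. cnj (h \<omega>) * iexp (t * Y \<omega>) \<partial>M) = (\<integral>\<omega>. cnj (h \<omega> * iexp (- t * Y \<omega>)) \<partial>M)"
      unfolding complex_cnj_mult c ..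
    also have "\<dots> = cnj (\<integral>\<omega>. h \<omega> * iexp (- t * Y \<omega>) \<partial>M)"
      by (rule Bochner_Integration.integral_cnj)
    also have "\<dots> = cnj (\<integral>\<omega>. h \<omega> \<partial>M) * (\<integral>\<omega>. cnj (iexp (- t * Y \<omega>)) \<partial>M)"
      unfolding eq complex_cnj_mult Bochner_Integration.integral_cnj ..
    finally show ?thesis unfolding c .
  qed
  have [measurable]: "(\<lambda>\<omega>. cnj (h \<omega>)) \<in> borel_measurable M"
    by (intro borel_measurable_continuous_on[OF _ h] continuous_intros)
  have ic: "integrable M (\<lambda>\<omega>. cnj (h \<omega>) * iexp (t * Y \<omega>))" for t
    by (rule integrable_const_bound[of _ K]) (auto simp: norm_mult bound)
  have R: "(\<integral>\<omega>. Re (h \<omega>) * indicator S (Y \<omega>) \<partial>M) = (\<integral>\<omega>. Re (h \<omega>) \<partial>M) * (\<integral>\<omega>. indicator S (Y \<omega>) \<partial>M)"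
  proof (rule uncorrelated_indicator_real[of _ _ K])
    show "\<bar>Re (h \<omega>)\<bar> \<le> K" for \<omega> using abs_Re_le_cmod[of "h \<omega>"] bound[of \<omega>] by linarith
    fix t
    have "(\<integral>\<omega>. complex_of_real (Re (h \<omega>)) * iexp (t * Y \<omega>) \<partial>M) =
        (\<integral>\<omega>. (h \<omega> * iexp (t * Y \<omega>) + cnj (h \<omega>) * iexp (t * Y \<omega>)) / 2 \<partial>M)"
      by (intro Bochner_Integration.integral_cong refl)
         (simp add: complex_add_cnj flip: distrib_right)
    also have "\<dots> = ((\<integral>\<omega>. h \<omega> * iexp (t * Y \<omega>) \<partial>M) + (\<integral>\<omega>. cnj (h \<omega>) * iexp (t * Y \<omega>) \<partial>M)) / 2"
      using i1[of t] ic[of t] by (simp only: integral_divide_zero Bochner_Integration.integral_add)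
    also have "\<dots> = ((\<integral>\<omega>. h \<omega> \<partial>M) + cnj (\<integral>\<omega>. h \<omega> \<partial>M)) / 2 * (\<integral>\<omega>. iexp (t * Y \<omega>) \<partial>M)"
      unfolding eq eqc by (simp add: distrib_right)
    finally show "(\<integral>\<omega>. complex_of_real (Re (h \<omega>)) * iexp (t * Y \<omega>) \<partial>M) =
        complex_of_real (\<integral>\<omega>. Re (h \<omega>) \<partial>M) * (\<integral>\<omega>. iexp (t * Y \<omega>) \<partial>M)"
      using ih by (simp add: complex_add_cnj)
  qed simp_all
  have I: "(\<integral>\<omega>. Im (h \<omega>) * indicator S (Y \<omega>) \<partial>M) = (\<integral>\<omega>. Im (h \<omega>) \<partial>M) * (\<integral>\<omega>. indicator S (Y \<omega>) \<partial>M)"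
  proof (rule uncorrelated_indicator_real[of _ _ K])
    show "\<bar>Im (h \<omega>)\<bar> \<le> K" for \<omega> using abs_Im_le_cmod[of "h \<omega>"] bound[of \<omega>] by linarith
    fix t
    have "(\<integral>\<omega>. complex_of_real (Im (h \<omega>)) * iexp (t * Y \<omega>) \<partial>M) =
        (\<integral>\<omega>. (h \<omega> * iexp (t * Y \<omega>) - cnj (h \<omega>) * iexp (t * Y \<omega>)) / (2 * \<i>) \<partial>M)"
      by (intro Bochner_Integration.integral_cong refl)
         (simp only: complex_diff_cnj left_diff_distrib[symmetric], simp add: field_simps)
    also have "\<dots> = ((\<integral>\<omega>. h \<omega> * iexp (t * Y \<omega>) \<partial>M) - (\<integral>\<omega>. cnj (h \<omega>) * iexp (t * Y \<omega>) \<partial>M)) / (2 * \<i>)"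
      using i1[of t] ic[of t] by (simp only: integral_divide_zero Bochner_Integration.integral_diff)
    also have "\<dots> = ((\<integral>\<omega>. h \<omega> \<partial>M) - cnj (\<integral>\<omega>. h \<omega> \<partial>M)) / (2 * \<i>) * (\<integral>\<omega>. iexp (t * Y \<omega>) \<partial>M)"
      unfolding eq eqc by (simp add: left_diff_distrib)
    finally show "(\<integral>\<omega>. complex_of_real (Im (h \<omega>)) * iexp (t * Y \<omega>) \<partial>M) =
        complex_of_real (\<integral>\<omega>. Im (h \<omega>) \<partial>M) * (\<integral>\<omega>. iexp (t * Y \<omega>) \<partial>M)"
      using ih by (simp add: complex_diff_cnj field_simps)
  qed simp_all
  have i5: "integrable M (\<lambda>\<omega>. h \<omega> * indicator S (Y \<omega>))"
    using bound order_trans[OF norm_ge_zero bound]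
    by (intro integrable_const_bound[of _ K]) (auto simp: indicator_def)
  have "Re (h \<omega> * indicator S (Y \<omega>)) = Re (h \<omega>) * indicator S (Y \<omega>)"
    "Im (h \<omega> * indicator S (Y \<omega>)) = Im (h \<omega>) * indicator S (Y \<omega>)" for \<omega>
    by (auto simp: indicator_def)
  with R I have "Re (\<integral>\<omega>. h \<omega> * indicator S (Y \<omega>) \<partial>M) = Re (\<integral>\<omega>. h \<omega> \<partial>M) * (\<integral>\<omega>. indicator S (Y \<omega>) \<partial>M)"
    "Im (\<integral>\<omega>. h \<omega> * indicator S (Y \<omega>) \<partial>M) = Im (\<integral>\<omega>. h \<omega> \<partial>M) * (\<integral>\<omega>. indicator S (Y \<omega>) \<partial>M)"
    using i5 ih by (simp_all flip: integral_Re integral_Im)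
  then show ?thesis by (simp add: complex_eq_iff)
qed

text \<open>Each induction step turns the exponential of one variable into an indicator. The
  remaining product \<open>h\<close> is uncorrelated with \<open>iexp (t * X a \<omega>)\<close> for
  every \<open>t\<close> by the induction hypothesis for \<open>insert a B\<close>; this is why
  \<open>B\<close> and the frequencies \<open>s\<close> stay arbitrary.\<close>

lemma char_factorization_indicators:
  fixes X :: "'i \<Rightarrow> 'a \<Rightarrow> real"
  assumes X[measurable]: "\<And>i. i \<in> I \<Longrightarrow> X i \<in> borel_measurable M"
    and factor: "\<And>B s. B \<subseteq> I \<Longrightarrow> finite B \<Longrightarrow>
      (\<integral>\<omega>. iexp (\<Sum>k\<in>B. s k * X k \<omega>) \<partial>M) = (\<Prod>k\<in>B. \<integral>\<omega>. iexp (s k * X k \<omega>) \<partial>M)"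
    and S: "\<And>i. i \<in> I \<Longrightarrow> S i \<in> sets borel"
    and A: "finite A" "A \<subseteq> I" and B: "finite B" "B \<subseteq> I" "A \<inter> B = {}"
  shows "(\<integral>\<omega>. (\<Prod>k\<in>A. indicator (S k) (X k \<omega>)) * iexp (\<Sum>k\<in>B. s k * X k \<omega>) \<partial>M) =
    (\<Prod>k\<in>A. complex_of_real (\<integral>\<omega>. indicator (S k) (X k \<omega>) \<partial>M)) *
    (\<Prod>k\<in>B. \<integral>\<omega>. iexp (s k * X k \<omega>) \<partial>M)"
  using A B
proof (induction A arbitrary: B s rule: finite_induct)
  case empty
  then show ?case using factor[of B s] by (simp del: of_real_sum)
next
  case (insert a A)
  define h where "h \<omega> = (\<Prod>k\<in>A. indicator (S k) (X k \<omega>)) * iexp (\<Sum>k\<in>B. s k * X k \<omega>)" for \<omega>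
  have [measurable]: "S k \<in> sets borel" "X k \<in> borel_measurable M" if "k \<in> A" for k
    using S X that insert.prems by auto
  have [measurable]: "X k \<in> borel_measurable M" if "k \<in> B" for k
    using X that insert.prems by auto
  have [measurable]: "S a \<in> sets borel" "X a \<in> borel_measurable M"
    using S X insert.prems by auto
  have IH: "(\<integral>\<omega>. h \<omega> \<partial>M) = (\<Prod>k\<in>A. complex_of_real (\<integral>\<omega>. indicator (S k) (X k \<omega>) \<partial>M)) *
    (\<Prod>k\<in>B. \<integral>\<omega>. iexp (s k * X k \<omega>) \<partial>M)"
    unfolding h_def using insert by (intro insert.IH) auto
  have "(\<integral>\<omega>. h \<omega> * indicator (S a) (X a \<omega>) \<partial>M) =
    (\<integral>\<omega>. h \<omega> \<partial>M) * complex_of_real (\<integral>\<omega>. indicator (S a) (X a \<omega>) \<partial>M)"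
  proof (rule uncorrelated_indicator_complex[of _ _ 1])
    show "h \<in> borel_measurable M" unfolding h_def by measurable
    show "norm (h \<omega>) \<le> 1" for \<omega>
      unfolding h_def norm_mult prod_norm[symmetric] norm_exp_i_times mult_1_right
      by (intro prod_le_1) (auto simp: indicator_def)
    fix t
    have "a \<notin> B" using insert.prems by auto
    then have sm: "(\<Sum>k\<in>B. (if k = a then t else s k) * X k \<omega>) = (\<Sum>k\<in>B. s k * X k \<omega>)"
      "(\<Prod>k\<in>B. \<integral>\<omega>. iexp ((if k = a then t else s k) * X k \<omega>) \<partial>M) = (\<Prod>k\<in>B. \<integral>\<omega>. iexp (s k * X k \<omega>) \<partial>M)" for \<omega>
      by (auto intro!: sum.cong prod.cong)
    \<comment> \<open>Since \<open>a\<close> is not in \<open>B\<close>, its frequency can be set to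
      \<open>t\<close> without changing the other factors.\<close>
    have "(\<integral>\<omega>. h \<omega> * iexp (t * X a \<omega>) \<partial>M) =
      (\<integral>\<omega>. (\<Prod>k\<in>A. indicator (S k) (X k \<omega>)) * iexp (\<Sum>k\<in>insert a B. (s(a := t)) k * X k \<omega>) \<partial>M)"
      using \<open>a \<notin> B\<close> insert.prems sm
      by (intro Bochner_Integration.integral_cong refl)
         (simp add: h_def sum.insert exp_add algebra_simps)
    also have "\<dots> = (\<Prod>k\<in>A. complex_of_real (\<integral>\<omega>. indicator (S k) (X k \<omega>) \<partial>M)) *
      (\<Prod>k\<in>insert a B. \<integral>\<omega>. iexp ((s(a := t)) k * X k \<omega>) \<partial>M)"
      using insert by (intro insert.IH) auto
    also have "\<dots> = (\<integral>\<omega>. h \<omega> \<partial>M) * (\<integral>\<omega>. iexp (t * X a \<omega>) \<partial>M)"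
      unfolding IH using \<open>a \<notin> B\<close> insert.prems sm by (simp add: prod.insert mult_ac)
    finally show "(\<integral>\<omega>. h \<omega> * iexp (t * X a \<omega>) \<partial>M) = (\<integral>\<omega>. h \<omega> \<partial>M) * (\<integral>\<omega>. iexp (t * X a \<omega>) \<partial>M)" .
  qed simp_all
  then show ?case
    unfolding IH using insert.hyps by (simp add: h_def mult_ac)
qed

text \<open>Kac's theorem. With every exponential replaced, so \<open>B = {}\<close>, the mixed
  factorisation is the product rule for the events that generate the sigma-algebras of the
  \<open>X i\<close>.\<close>

theorem indep_vars_if_char_factors:
  fixes X :: "'i \<Rightarrow> 'a \<Rightarrow> real"
  assumes X[measurable]: "\<And>i. i \<in> I \<Longrightarrow> X i \<in> borel_measurable M"
    and factor: "\<And>B s. B \<subseteq> I \<Longrightarrow> finite B \<Longrightarrow>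
      (\<integral>\<omega>. iexp (\<Sum>k\<in>B. s k * X k \<omega>) \<partial>M) = (\<Prod>k\<in>B. \<integral>\<omega>. iexp (s k * X k \<omega>) \<partial>M)"
  shows "indep_vars (\<lambda>_. borel) X I"
  unfolding indep_vars_def2 indep_sets_def
proof (intro conjI ballI allI impI)
  show "X i \<in> borel_measurable M" if "i \<in> I" for i using X that .
  show "{X i -` A \<inter> space M |A. A \<in> sets borel} \<subseteq> events" if "i \<in> I" for i
    using measurable_sets[OF X[OF that]] by auto
  fix A D assume A: "A \<subseteq> I" "A \<noteq> {}" "finite A"
    and D: "D \<in> Pi A (\<lambda>i. {X i -` A \<inter> space M |A. A \<in> sets borel})"
  \<comment> \<open>The sets are chosen at indices outside \<open>A\<close> as well, because the
    factorisation takes a family of Borel sets over all of \<open>I\<close>.\<close>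
  have "\<exists>S. S \<in> sets borel \<and> (i \<in> A \<longrightarrow> D i = X i -` S \<inter> space M)" for i
    using D by (cases "i \<in> A") (fastforce simp: Pi_iff)+
  then obtain S where S: "\<And>i. S i \<in> sets borel" "\<And>i. i \<in> A \<Longrightarrow> D i = X i -` S i \<inter> space M"
    by metis
  have Dm: "D i \<in> events" if "i \<in> A" for i
    using S that A measurable_sets[OF X] by auto
  have ind: "indicator (S i) (X i \<omega>) = (indicator (D i) \<omega> :: real)" if "i \<in> A" "\<omega> \<in> space M" for i \<omega>
    using S that by (auto simp: indicator_def)
  have 1: "(\<integral>\<omega>. indicator (S i) (X i \<omega>) \<partial>M) = prob (D i)" if "i \<in> A" for i
    using Dm[OF that] ind[OF that] by (simp cong: Bochner_Integration.integral_cong)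
  have "(\<Prod>k\<in>A. indicator (S k) (X k \<omega>)) = complex_of_real (indicator (\<Inter>j\<in>A. D j) \<omega>)"
    if "\<omega> \<in> space M" for \<omega>
  proof -
    have "(\<Prod>k\<in>A. indicator (S k) (X k \<omega>)) = complex_of_real (\<Prod>k\<in>A. indicator (S k) (X k \<omega>))"
      by (simp only: of_real_prod of_real_indicator)
    also have "(\<Prod>k\<in>A. indicator (S k) (X k \<omega>)) = (indicator (\<Inter>j\<in>A. D j) \<omega> :: real)"
      using ind that A by (auto simp: indicator_def prod_zero_iff intro!: prod.neutral)
    finally show ?thesis .
  qed
  then have "complex_of_real (prob (\<Inter>j\<in>A. D j)) = (\<integral>\<omega>. (\<Prod>k\<in>A. indicator (S k) (X k \<omega>)) \<partial>M)"
    using A Dm by (simp add: sets.finite_INT cong: Bochner_Integration.integral_cong)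
  also have "\<dots> = (\<Prod>k\<in>A. complex_of_real (\<integral>\<omega>. indicator (S k) (X k \<omega>) \<partial>M))"
    using char_factorization_indicators[where A=A and B="{}" and I=I and S=S and X=X] X factor S(1) A by simp
  also have "\<dots> = complex_of_real (\<Prod>j\<in>A. prob (D j))" using 1 by simp
  finally show "prob (\<Inter>j\<in>A. D j) = (\<Prod>j\<in>A. prob (D j))" by (simp only: of_real_eq_iff)
qed

end


section \<open>Linearity and laws of a Gaussian family\<close>

lemma normal_char_function:
  assumes "prob_space M" and Y: "distributed M lborel Y (\<lambda>x. ennreal (normal_density 0 \<sigma> x))" and s: "\<sigma> > 0"
  shows "(\<integral>\<omega>. iexp (t * Y \<omega>) \<partial>M) = exp (- (t * \<sigma>)\<^sup>2 / 2)"
proof -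
  interpret prob_space M by fact
  have D: "distributed M lborel (\<lambda>\<omega>. Y \<omega> / \<sigma>) std_normal_density"
    using normal_standard_normal_convert[OF s, of Y 0] Y by simp
  then have [measurable]: "(\<lambda>\<omega>. Y \<omega> / \<sigma>) \<in> borel_measurable M"
    by (simp add: distributed_def)
  have "char std_normal_distribution (t * \<sigma>) = (\<integral>x. iexp (t * \<sigma> * x) \<partial>distr M lborel (\<lambda>\<omega>. Y \<omega> / \<sigma>))"
    using D by (simp add: char_def distributed_def)
  also have "\<dots> = (\<integral>\<omega>. iexp (t * Y \<omega>) \<partial>M)"
    using s by (subst integral_distr) auto
  finally show ?thesis by (simp add: char_std_normal_distribution)
qed

context gaussian_space
begin

lemma W_measurable[measurable]: "W f \<in> borel_measurable M"
  using W_gaussian[of f] by (simp add: centered_gaussian_def)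

text \<open>The second moment decides between the alternatives of \<open>centered_gaussian\<close>:
  it is 0 in the degenerate case and the square of \<sigma> in the normal case, while the covariance
  makes it \<open>f \<bullet> f\<close>.\<close>

lemma W_zero_or_normal:
  shows "f = 0 \<Longrightarrow> AE \<omega> in M. W f \<omega> = 0"
    and "f \<noteq> 0 \<Longrightarrow> distributed M lborel (W f) (\<lambda>x. ennreal (normal_density 0 (norm f) x))"
proof -
  have ff: "(\<integral>\<omega>. (W f \<omega>)\<^sup>2 \<partial>M) = f \<bullet> f"
    using W_covariance[of f f] by (simp add: power2_eq_square)
  have *: "f \<bullet> f = \<sigma>\<^sup>2" if "distributed M lborel (W f) (\<lambda>x. ennreal (normal_density 0 \<sigma> x))" "\<sigma> > 0" for \<sigma>
    using normal_distributed_variance[OF that(2,1)] normal_distributed_expectation[OF that(2,1)] ff by simp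
  show "AE \<omega> in M. W f \<omega> = 0" if "f = 0"
    using W_gaussian[of f] * that by (auto simp: centered_gaussian_def)
  show "distributed M lborel (W f) (\<lambda>x. ennreal (normal_density 0 (norm f) x))" if "f \<noteq> 0"
  proof -
    have "\<not> (AE \<omega> in M. W f \<omega> = 0)"
    proof
      assume "AE \<omega> in M. W f \<omega> = 0"
      then have "(\<integral>\<omega>. (W f \<omega>)\<^sup>2 \<partial>M) = (\<integral>\<omega>. 0 \<partial>M)"
        by (intro integral_cong_AE) auto
      with ff that show False by simp
    qed
    then obtain \<sigma> where s: "distributed M lborel (W f) (\<lambda>x. ennreal (normal_density 0 \<sigma> x))" "\<sigma> > 0"
      using W_gaussian[of f] by (auto simp: centered_gaussian_def)
    with *[OF s] have "norm f = \<sigma>" by (simp add: norm_eq_sqrt_inner)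
    with s show ?thesis by simp
  qed
qed

lemma W_char: "(\<integral>\<omega>. iexp (t * W f \<omega>) \<partial>M) = exp (- (t * norm f)\<^sup>2 / 2)"
proof (cases "f = 0")
  case True
  have "(\<integral>\<omega>. iexp (t * W f \<omega>) \<partial>M) = (\<integral>\<omega>. 1 \<partial>M)"
    using W_zero_or_normal(1)[OF True] by (intro integral_cong_AE) auto
  with True show ?thesis by (simp add: prob_space)
next
  case False
  with normal_char_function[OF prob_space_axioms W_zero_or_normal(2)[OF False]] show ?thesis by simp
qed

lemma W_square_integrable: "integrable M (\<lambda>\<omega>. (W f \<omega>)\<^sup>2)"
proof (cases "f = 0")
  case True
  have "integrable M (\<lambda>\<omega>. (W f \<omega>)\<^sup>2) \<longleftrightarrow> integrable M (\<lambda>\<omega>. 0 :: real)"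
    using W_zero_or_normal(1)[OF True] by (intro integrable_cong_AE) auto
  then show ?thesis by simp
next
  case False
  have "integrable lborel (\<lambda>x. normal_density 0 (norm f) x * x\<^sup>2)"
    using integrable_normal_moment[of "norm f" 0 2] False by simp
  then show ?thesis
    using distributed_integrable[OF W_zero_or_normal(2)[OF False], of "\<lambda>x. x\<^sup>2"] by simp
qed

text \<open>For orthogonal \<open>f\<close> and \<open>g\<close> the covariance identity would also
  hold for a divergent integral, whose value is 0. Integrability is therefore derived from the
  second moments.\<close>

lemma W_mult_integrable[simp]: "integrable M (\<lambda>\<omega>. W f \<omega> * W g \<omega>)"
proof (rule Bochner_Integration.integrable_bound)
  show "integrable M (\<lambda>\<omega>. (W f \<omega>)\<^sup>2 + (W g \<omega>)\<^sup>2)"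
    by (intro Bochner_Integration.integrable_add W_square_integrable)
  show "AE \<omega> in M. norm (W f \<omega> * W g \<omega>) \<le> norm ((W f \<omega>)\<^sup>2 + (W g \<omega>)\<^sup>2)"
  proof (rule AE_I2)
    fix \<omega>
    have "2 * (\<bar>W f \<omega>\<bar> * \<bar>W g \<omega>\<bar>) \<le> (W f \<omega>)\<^sup>2 + (W g \<omega>)\<^sup>2"
      using sum_squares_bound[of "\<bar>W f \<omega>\<bar>" "\<bar>W g \<omega>\<bar>"] by (simp add: mult.assoc)
    moreover have "0 \<le> \<bar>W f \<omega>\<bar> * \<bar>W g \<omega>\<bar>" by simp
    ultimately show "norm (W f \<omega> * W g \<omega>) \<le> norm ((W f \<omega>)\<^sup>2 + (W g \<omega>)\<^sup>2)"
      unfolding real_norm_def abs_mult by linarith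
  qed
qed simp

lemma W_integrable[simp]: "integrable M (W f)"
  using square_integrable_imp_integrable[OF W_measurable W_square_integrable] .

text \<open>Linearity is forced by the covariance: the second moment of the difference expands to
  \<open>?u \<bullet> ?u\<close> with coefficients 1, -2 and 1.\<close>

lemma W_linear: "AE \<omega> in M. W (\<Sum>k\<in>B. s k *\<^sub>R h k) \<omega> = (\<Sum>k\<in>B. s k * W (h k) \<omega>)"
proof -
  let ?u = "\<Sum>k\<in>B. s k *\<^sub>R h k"
  have eq: "(W ?u \<omega> - (\<Sum>k\<in>B. s k * W (h k) \<omega>))\<^sup>2 =
      W ?u \<omega> * W ?u \<omega> - 2 * (\<Sum>k\<in>B. s k * (W ?u \<omega> * W (h k) \<omega>)) +
      (\<Sum>k\<in>B. \<Sum>l\<in>B. s k * s l * (W (h k) \<omega> * W (h l) \<omega>))" for \<omega>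
  proof -
    have 1: "(\<Sum>k\<in>B. s k * W (h k) \<omega>) * (\<Sum>k\<in>B. s k * W (h k) \<omega>) =
       (\<Sum>k\<in>B. \<Sum>l\<in>B. s k * s l * (W (h k) \<omega> * W (h l) \<omega>))"
      unfolding sum_product by (intro sum.cong refl) (simp add: mult_ac)
    have 2: "(\<Sum>k\<in>B. s k * (W ?u \<omega> * W (h k) \<omega>)) = W ?u \<omega> * (\<Sum>k\<in>B. s k * W (h k) \<omega>)"
      unfolding sum_distrib_left by (intro sum.cong refl) (simp add: mult_ac)
    show ?thesis
      unfolding 1[symmetric] 2 by (simp add: power2_eq_square algebra_simps)
  qed
  have int: "integrable M (\<lambda>\<omega>. (W ?u \<omega> - (\<Sum>k\<in>B. s k * W (h k) \<omega>))\<^sup>2)"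
    unfolding eq by (intro Bochner_Integration.integrable_add Bochner_Integration.integrable_diff
      Bochner_Integration.integrable_sum integrable_mult_right W_mult_integrable)
  have "(\<integral>\<omega>. (W ?u \<omega> - (\<Sum>k\<in>B. s k * W (h k) \<omega>))\<^sup>2 \<partial>M) =
      ?u \<bullet> ?u - 2 * (\<Sum>k\<in>B. s k * (?u \<bullet> h k)) + (\<Sum>k\<in>B. \<Sum>l\<in>B. s k * s l * (h k \<bullet> h l))"
    unfolding eq by (simp add: W_covariance Bochner_Integration.integrable_sum)
  also have "(\<Sum>k\<in>B. s k * (?u \<bullet> h k)) = ?u \<bullet> ?u"
    by (simp only: inner_sum_right inner_scaleR_right)
  also have "(\<Sum>k\<in>B. \<Sum>l\<in>B. s k * s l * (h k \<bullet> h l)) = ?u \<bullet> ?u"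
    by (simp add: inner_sum_right inner_sum_left sum_distrib_left mult_ac)
       (subst sum.swap, simp add: inner_commute mult_ac)
  finally have "(\<integral>\<omega>. (W ?u \<omega> - (\<Sum>k\<in>B. s k * W (h k) \<omega>))\<^sup>2 \<partial>M) = 0" by simp
  then have "AE \<omega> in M. (W ?u \<omega> - (\<Sum>k\<in>B. s k * W (h k) \<omega>))\<^sup>2 = 0"
    using int by (subst (asm) integral_nonneg_eq_0_iff_AE) auto
  then show ?thesis by simp
qed

end


section \<open>Gaussian integration by parts\<close>

text \<open>Stein's identity. The density satisfies \<rho>' = - x \<rho>, so the difference of the
  two integrands is the derivative of \<rho> f. Its integral over the line is a difference of
  boundary limits, which vanish because \<open>f\<close> is bounded and \<rho> tends to 0.\<close>

lemma std_normal_integration_by_parts: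
  fixes f f' :: "real \<Rightarrow> real"
  assumes deriv: "\<And>x. (f has_real_derivative f' x) (at x)"
    and cont: "continuous_on UNIV f'"
    and bound: "\<And>x. \<bar>f x\<bar> \<le> K" "\<And>x. \<bar>f' x\<bar> \<le> K"
  shows "(\<integral>x. std_normal_density x * f' x \<partial>lborel) = (\<integral>x. std_normal_density x * (x * f x) \<partial>lborel)"
proof -
  have contf: "continuous_on UNIV f"
    using deriv by (meson DERIV_isCont continuous_at_imp_continuous_on)
  have [measurable]: "f \<in> borel_measurable borel" "f' \<in> borel_measurable borel"
    using contf cont by (auto intro: borel_measurable_continuous_onI)
  have K: "0 \<le> K" using order_trans[OF abs_ge_zero bound(1)] .
  let ?\<rho> = std_normal_density
  have d\<rho>: "(?\<rho> has_real_derivative - x * ?\<rho> x) (at x)" for x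
  proof -
    have "((\<lambda>x. c * exp (- x\<^sup>2 / 2)) has_real_derivative - x * (c * exp (- x\<^sup>2 / 2))) (at x)" for c :: real
      by (auto intro!: derivative_eq_intros)
    then show ?thesis unfolding std_normal_density_def[abs_def] .
  qed
  have c\<rho>: "continuous_on UNIV ?\<rho>"
    using d\<rho> by (meson DERIV_isCont continuous_at_imp_continuous_on)
  define g where "g x = ?\<rho> x * f' x - ?\<rho> x * (x * f x)" for x
  have i1: "integrable lborel (\<lambda>x. ?\<rho> x * f' x)"
  proof (rule Bochner_Integration.integrable_bound)
    show "integrable lborel (\<lambda>x. ?\<rho> x * K)" by simp
    show "AE x in lborel. norm (?\<rho> x * f' x) \<le> norm (?\<rho> x * K)"
      using bound K by (auto simp: abs_mult intro!: mult_left_mono)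
  qed measurable
  have i2: "integrable lborel (\<lambda>x. ?\<rho> x * (x * f x))"
  proof (rule Bochner_Integration.integrable_bound)
    show "integrable lborel (\<lambda>x. ?\<rho> x * \<bar>x\<bar>^1 * K)"
      by (intro integrable_mult_left integrable_std_normal_moment_abs)
    show "AE x in lborel. norm (?\<rho> x * (x * f x)) \<le> norm (?\<rho> x * \<bar>x\<bar>^1 * K)"
      using bound K by (auto simp: abs_mult mult.assoc intro!: mult_left_mono)
  qed measurable
  have ig: "integrable lborel g" unfolding g_def using i1 i2 by auto
  have lim: "((\<lambda>x. ?\<rho> x * f x) \<longlongrightarrow> 0) F" if "(?\<rho> \<longlongrightarrow> 0) F" for F
  proof (rule tendsto_0_le[OF that, of _ K])
    show "\<forall>\<^sub>F x in F. norm (?\<rho> x * f x) \<le> norm (?\<rho> x) * K"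
      using bound by (auto simp: abs_mult intro!: mult_left_mono always_eventually)
  qed
  have "(LBINT x=-\<infinity>..\<infinity>. g x) = 0 - 0"
  proof (rule interval_integral_FTC_integrable)
    show "((\<lambda>x. ?\<rho> x * f x) has_vector_derivative g x) (at x)" for x
      unfolding has_real_derivative_iff_has_vector_derivative[symmetric]
      using d\<rho> deriv by (auto intro!: derivative_eq_intros simp: g_def)
    show "isCont g x" for x
    proof -
      have "continuous_on UNIV g"
        unfolding g_def by (intro continuous_intros c\<rho> cont contf)
      then show ?thesis by (simp add: continuous_on_eq_continuous_at)
    qed
    show "set_integrable lborel (einterval (-\<infinity>) \<infinity>) g"
      using ig by (simp add: set_integrable_def)
    have top: "(?\<rho> \<longlongrightarrow> 0) at_top" "(?\<rho> \<longlongrightarrow> 0) at_bot"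
      unfolding std_normal_density_def by real_asymp+
    show "(((\<lambda>x. ?\<rho> x * f x) \<circ> real_of_ereal) \<longlongrightarrow> 0) (at_right (-\<infinity>))"
      using lim[OF top(2)] by (simp only: ereal_tendsto_simps)
    show "(((\<lambda>x. ?\<rho> x * f x) \<circ> real_of_ereal) \<longlongrightarrow> 0) (at_left \<infinity>)"
      using lim[OF top(1)] by (simp only: ereal_tendsto_simps)
  qed simp
  then have "(\<integral>x. g x \<partial>lborel) = 0"
    by (simp add: interval_lebesgue_integral_def set_lebesgue_integral_def)
  then show ?thesis unfolding g_def using i1 i2 by simp
qed

context gaussian_space
begin

text \<open>Linearity replaces the joint exponent by the single variable \<open>W ?u\<close>, and
  Pythagoras splits the Gaussian exponential of \<open>norm ?u\<close> into one factor for each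
  coordinate.\<close>

lemma W_orthonormal_indep:
  assumes on: "\<And>i j. i \<in> I \<Longrightarrow> j \<in> I \<Longrightarrow> e i \<bullet> e j = (if i = j then 1 else 0)"
  shows "indep_vars (\<lambda>_. borel) (\<lambda>i. W (e i)) I"
proof (rule indep_vars_if_char_factors)
  fix B and s :: "_ \<Rightarrow> real" assume B: "B \<subseteq> I" "finite B"
  let ?u = "\<Sum>k\<in>B. s k *\<^sub>R e k"
  have "(\<integral>\<omega>. iexp (\<Sum>k\<in>B. s k * W (e k) \<omega>) \<partial>M) = (\<integral>\<omega>. iexp (1 * W ?u \<omega>) \<partial>M)"
    using W_linear[of s e B] by (intro integral_cong_AE) auto
  also have "\<dots> = exp (- (norm ?u)\<^sup>2 / 2)" unfolding W_char by simp
  also have "(norm ?u)\<^sup>2 = (\<Sum>k\<in>B. \<Sum>l\<in>B. if k = l then (s k)\<^sup>2 else 0)"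
    unfolding power2_norm_eq_inner inner_sum_left inner_sum_right using B on
    by (intro sum.cong refl) (auto simp: power2_eq_square subset_iff)
  also have "\<dots> = (\<Sum>k\<in>B. (s k)\<^sup>2)" using B by simp
  also have "complex_of_real (exp (- (\<Sum>k\<in>B. (s k)\<^sup>2) / 2)) = complex_of_real (\<Prod>k\<in>B. exp (- (s k)\<^sup>2 / 2))"
    using B by (simp add: exp_sum[symmetric] sum_negf sum_divide_distrib del: of_real_prod)
  also have "\<dots> = (\<Prod>k\<in>B. \<integral>\<omega>. iexp (s k * W (e k) \<omega>) \<partial>M)"
    unfolding W_char of_real_prod using B on
    by (intro prod.cong refl) (auto simp: subset_iff norm_eq_sqrt_inner)
  finally show "(\<integral>\<omega>. iexp (\<Sum>k\<in>B. s k * W (e k) \<omega>) \<partial>M) = (\<Prod>k\<in>B. \<integral>\<omega>. iexp (s k * W (e k) \<omega>) \<partial>M)" .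
qed simp

lemma continuous_W_measurable:
  fixes f :: "(nat \<Rightarrow> real) \<Rightarrow> real"
  assumes "continuous_on UNIV f"
  shows "(\<lambda>\<omega>. f (\<lambda>i. W (e i) \<omega>)) \<in> borel_measurable M"
proof (rule borel_measurable_continuous_on[OF assms])
  show "(\<lambda>\<omega> i. W (e i) \<omega>) \<in> borel_measurable M"
    by (rule measurable_coordinatewise_then_product) simp
qed

text \<open>By independence, the one-dimensional formula can be applied in the \<open>j\<close>-th coordinate with all
  others frozen.\<close>

theorem gaussian_integration_by_parts:
  fixes f f' :: "(nat \<Rightarrow> real) \<Rightarrow> real"
  assumes on: "\<And>i j. i \<in> I \<Longrightarrow> j \<in> I \<Longrightarrow> e i \<bullet> e j = (if i = j then 1 else 0)"
    and j: "j \<in> I"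
    and dep: "\<And>x y. (\<And>i. i \<in> I \<Longrightarrow> x i = y i) \<Longrightarrow> f x = f y \<and> f' x = f' y"
    and cont: "continuous_on UNIV f" "continuous_on UNIV f'"
    and bound: "\<And>x. \<bar>f x\<bar> \<le> K" "\<And>x. \<bar>f' x\<bar> \<le> K"
    and deriv: "\<And>x. ((\<lambda>t. f (x(j := t))) has_real_derivative f' x) (at (x j))"
  shows "(\<integral>\<omega>. f' (\<lambda>i. W (e i) \<omega>) \<partial>M) = (\<integral>\<omega>. W (e j) \<omega> * f (\<lambda>i. W (e i) \<omega>) \<partial>M)"
proof -
  define T where "T = I - {j}"
  define V where "V \<omega> = (\<lambda>i. W (e i) \<omega>)" for \<omega>
  define Z where "Z \<omega> = restrict (V \<omega>) T" for \<omega>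
  let ?P = "PiM T (\<lambda>_. borel :: real measure)"
  define q where "q p = (\<lambda>i. if i = j then fst p else if i \<in> T then snd p i else 0)"
    for p :: "real \<times> (nat \<Rightarrow> real)"
  have Zm[measurable]: "Z \<in> M \<rightarrow>\<^sub>M ?P"
    unfolding Z_def V_def by (intro measurable_restrict) simp
  \<comment> \<open>Restricting an independent family to disjoint index sets gives variables with
    values in product spaces, so the single coordinate appears as a function on \<open>{j}\<close>
    and is read off as \<open>R \<omega> j\<close>.\<close>
  let ?Q = "PiM {j} (\<lambda>_. borel :: real measure)"
  define R where "R \<omega> = restrict (V \<omega>) {j}" for \<omega>
  have Rm[measurable]: "R \<in> M \<rightarrow>\<^sub>M ?Q"
    unfolding R_def V_def by (intro measurable_restrict) simp
  have Rj[simp]: "R \<omega> j = W (e j) \<omega>" for \<omega> by (simp add: R_def V_def)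
  have "indep_var ?Q R ?P Z"
    unfolding R_def Z_def V_def
    using j by (intro indep_var_restrict[OF W_orthonormal_indep[OF on]]) (auto simp: T_def)
  then have D: "distr M ?Q R \<Otimes>\<^sub>M distr M ?P Z = distr M (?Q \<Otimes>\<^sub>M ?P) (\<lambda>\<omega>. (R \<omega>, Z \<omega>))"
    by (simp add: indep_var_distribution_eq)
  let ?G = "distr M ?Q R" and ?N = "distr M ?P Z"
  interpret G: prob_space ?G by (rule prob_space_distr) simp
  interpret N: prob_space ?N by (rule prob_space_distr) simp
  interpret pair_sigma_finite ?G ?N ..
  have [measurable]: "f \<in> borel_measurable borel" "f' \<in> borel_measurable borel"
    using cont by (auto intro: borel_measurable_continuous_onI)
  have [measurable]: "q \<in> borel \<Otimes>\<^sub>M ?P \<rightarrow>\<^sub>M borel"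
  proof (rule measurable_coordinatewise_then_product)
    show "(\<lambda>p. q p i) \<in> borel_measurable (borel \<Otimes>\<^sub>M ?P)" for i
      unfolding q_def by (cases "i = j"; cases "i \<in> T") auto
  qed
  have qV: "f (V \<omega>) = f (q (W (e j) \<omega>, Z \<omega>)) \<and> f' (V \<omega>) = f' (q (W (e j) \<omega>, Z \<omega>))" for \<omega>
    by (rule dep) (auto simp: V_def q_def Z_def T_def)
  \<comment> \<open>Independence makes the joint law a product, so Fubini allows the j-th coordinate
    to be integrated first, for each frozen \<open>z\<close>.\<close>
  have transfer: "(\<integral>\<omega>. h (W (e j) \<omega>, Z \<omega>) \<partial>M) = (\<integral>z. (\<integral>r. h (r j, z) \<partial>?G) \<partial>?N)"
    if h[measurable]: "h \<in> borel_measurable (borel \<Otimes>\<^sub>M ?P)" and int: "integrable M (\<lambda>\<omega>. h (W (e j) \<omega>, Z \<omega>))"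
    for h :: "_ \<Rightarrow> real"
  proof -
    have int': "integrable (?G \<Otimes>\<^sub>M ?N) (\<lambda>(r, z). h (r j, z))"
      unfolding D using int by (subst integrable_distr_eq) auto
    have "(\<integral>\<omega>. h (W (e j) \<omega>, Z \<omega>) \<partial>M) = (\<integral>(r, z). h (r j, z) \<partial>(?G \<Otimes>\<^sub>M ?N))"
      unfolding D by (subst integral_distr) auto
    also have "\<dots> = (\<integral>z. (\<integral>r. h (r j, z) \<partial>?G) \<partial>?N)"
      using integral_snd[OF int'] by simp
    finally show ?thesis .
  qed
  have normal: "distributed M lborel (W (e j)) std_normal_density"
    using W_zero_or_normal(2)[of "e j"] on[OF j j] by (cases "e j = 0") (auto simp: norm_eq_sqrt_inner)
  have G: "(\<integral>r. g (r j) \<partial>?G) = (\<integral>y. std_normal_density y * g y \<partial>lborel)"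
    if [measurable]: "g \<in> borel_measurable borel" for g :: "real \<Rightarrow> real"
    using distributed_integral[OF normal, of g] by (simp add: integral_distr)
  have [measurable]: "(\<lambda>y. q (y, z)) \<in> borel_measurable borel" for z
  proof (rule measurable_coordinatewise_then_product)
    show "(\<lambda>y. q (y, z) i) \<in> borel_measurable borel" for i
      unfolding q_def by (cases "i = j"; cases "i \<in> T") auto
  qed
  have inner: "(\<integral>r. f' (q (r j, z)) \<partial>?G) = (\<integral>r. r j * f (q (r j, z)) \<partial>?G)" for z
  proof -
    have "((\<lambda>y. f (q (y, z))) has_real_derivative f' (q (y, z))) (at y)" for y
      using deriv[of "q (y, z)"] by (simp add: q_def fun_upd_def cong: if_cong)
    moreover have "continuous_on UNIV (\<lambda>y. f' (q (y, z)))"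
    proof (rule continuous_on_compose2[OF cont(2)])
      show "continuous_on UNIV (\<lambda>y. q (y, z))"
      proof (rule continuous_on_coordinatewise_then_product)
        show "continuous_on UNIV (\<lambda>y. q (y, z) i)" for i
          unfolding q_def by (cases "i = j"; cases "i \<in> T") auto
      qed
    qed simp
    ultimately show ?thesis
      using std_normal_integration_by_parts[of "\<lambda>y. f (q (y, z))" "\<lambda>y. f' (q (y, z))" K] bound
      using G[of "\<lambda>y. f' (q (y, z))"] G[of "\<lambda>y. y * f (q (y, z))"] by simp
  qed
  have i1: "integrable M (\<lambda>\<omega>. f' (q (W (e j) \<omega>, Z \<omega>)))"
    using bound(2) by (intro integrable_const_bound[of _ K]) auto
  have i2: "integrable M (\<lambda>\<omega>. W (e j) \<omega> * f (q (W (e j) \<omega>, Z \<omega>)))"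
  proof (rule Bochner_Integration.integrable_bound)
    show "integrable M (\<lambda>\<omega>. W (e j) \<omega> * K)" by simp
    show "AE \<omega> in M. norm (W (e j) \<omega> * f (q (W (e j) \<omega>, Z \<omega>))) \<le> norm (W (e j) \<omega> * K)"
      using bound(1) by (auto simp: abs_mult intro!: mult_left_mono AE_I2 order_trans[OF bound(1) abs_ge_self])
  qed measurable
  have "(\<integral>\<omega>. f' (V \<omega>) \<partial>M) = (\<integral>z. (\<integral>r. f' (q (r j, z)) \<partial>?G) \<partial>?N)"
    using transfer[of "\<lambda>p. f' (q p)"] i1 qV by simp
  also have "\<dots> = (\<integral>z. (\<integral>r. r j * f (q (r j, z)) \<partial>?G) \<partial>?N)"
    by (simp only: inner)
  also have "\<dots> = (\<integral>\<omega>. W (e j) \<omega> * f (V \<omega>) \<partial>M)"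
    using transfer[of "\<lambda>p. fst p * f (q p)"] i2 qV by simp
  finally show ?thesis unfolding V_def .
qed

end


section \<open>Smooth cylindrical functions\<close>

text \<open>Schwarz's theorem. The second difference \<open>D\<close> over a small square, treated
  by the mean value theorem in either order, equals \<open>h * h\<close> times \<open>fxy\<close> at
  one interior point and \<open>h * h\<close> times \<open>fyx\<close> at another. Continuity at the
  corner forbids a gap.\<close>

lemma mixed_derivatives_eq:
  fixes f :: "real \<Rightarrow> real \<Rightarrow> real"
  assumes fx: "\<And>x y. ((\<lambda>s. f s y) has_real_derivative fx x y) (at x)"
    and fy: "\<And>x y. ((\<lambda>t. f x t) has_real_derivative fy x y) (at y)"
    and fxy: "\<And>x y. ((\<lambda>t. fx x t) has_real_derivative fxy x y) (at y)"
    and fyx: "\<And>x y. ((\<lambda>s. fy s y) has_real_derivative fyx x y) (at x)"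
    and cont: "isCont (\<lambda>(x, y). fxy x y) (a, b)" "isCont (\<lambda>(x, y). fyx x y) (a, b)"
  shows "fxy a b = fyx a b"
proof (rule ccontr)
  assume neq: "fxy a b \<noteq> fyx a b"
  \<comment> \<open>Half the gap: two deviations below \<open>d\<close> cannot bridge a distance of
    \<open>2 * d\<close>.\<close>
  define d where "d = \<bar>fxy a b - fyx a b\<bar> / 2"
  have "d > 0" using neq by (simp add: d_def)
  then obtain r1 r2 where r: "r1 > 0" "r2 > 0"
    "\<And>p. dist p (a, b) < r1 \<Longrightarrow> dist ((\<lambda>(x, y). fxy x y) p) (fxy a b) < d"
    "\<And>p. dist p (a, b) < r2 \<Longrightarrow> dist ((\<lambda>(x, y). fyx x y) p) (fyx a b) < d"
    using cont unfolding continuous_at_eps_delta by (metis case_prod_conv)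
  \<comment> \<open>Interior points of the square of side \<open>h\<close> lie within
    \<open>2 * h\<close> of the corner, hence the division by 2.\<close>
  define h where "h = min r1 r2 / 2"
  have h: "h > 0" "2 * h \<le> r1" "2 * h \<le> r2" using r by (auto simp: h_def)
  define D where "D = f (a + h) (b + h) - f (a + h) b - f a (b + h) + f a b"
  have near: "dist (x, y) (a, b) < 2 * h" if "a < x" "x < a + h" "b < y" "y < b + h" for x y
  proof -
    have "dist (x, y) (a, b) \<le> dist x a + dist y b"
      unfolding dist_prod_def by (simp add: sqrt_sum_squares_le_sum)
    with that show ?thesis by (simp add: dist_real_def)
  qed
  have "\<exists>x>a. x < a + h \<and> D = ((a + h) - a) * (fx x (b + h) - fx x b)"
    using MVT2[of a "a + h" "\<lambda>s. f s (b + h) - f s b" "\<lambda>x. fx x (b + h) - fx x b"] h fx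
    by (force simp: D_def intro!: DERIV_diff)
  then obtain x1 where x1: "a < x1" "x1 < a + h" "D = h * (fx x1 (b + h) - fx x1 b)" by auto
  obtain y1 where y1: "b < y1" "y1 < b + h" "fx x1 (b + h) - fx x1 b = h * fxy x1 y1"
    using MVT2[of b "b + h" "\<lambda>t. fx x1 t" "\<lambda>t. fxy x1 t"] h fxy by auto
  have "\<exists>y>b. y < b + h \<and> D = ((b + h) - b) * (fy (a + h) y - fy a y)"
    using MVT2[of b "b + h" "\<lambda>t. f (a + h) t - f a t" "\<lambda>y. fy (a + h) y - fy a y"] h fy
    by (force simp: D_def intro!: DERIV_diff)
  then obtain y2 where y2: "b < y2" "y2 < b + h" "D = h * (fy (a + h) y2 - fy a y2)" by auto
  obtain x2 where x2: "a < x2" "x2 < a + h" "fy (a + h) y2 - fy a y2 = h * fyx x2 y2"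
    using MVT2[of a "a + h" "\<lambda>s. fy s y2" "\<lambda>s. fyx s y2"] h fyx by auto
  have "h * (h * fxy x1 y1) = h * (h * fyx x2 y2)"
    using x1 y1 x2 y2 by simp
  then have "fxy x1 y1 = fyx x2 y2" using h by simp
  moreover have "\<bar>fxy x1 y1 - fxy a b\<bar> < d"
    using r(3)[of "(x1, y1)"] near[OF x1(1,2) y1(1,2)] h by (simp add: dist_real_def)
  moreover have "\<bar>fyx x2 y2 - fyx a b\<bar> < d"
    using r(4)[of "(x2, y2)"] near[OF x2(1,2) y2(1,2)] h by (simp add: dist_real_def)
  ultimately have "\<bar>fxy a b - fyx a b\<bar> < 2 * d" unfolding abs_less_iff by linarith
  then show False by (simp add: d_def)
qed

section \<open>Closure under partial derivatives, boundedness and symmetry of second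
  derivatives\<close>

lemma Cc_infinity_dep:
  assumes "\<phi> \<in> Cc_infinity n" "\<And>i. i \<in> {1..n} \<Longrightarrow> x i = y i"
  shows "\<phi> x = \<phi> y"
  using assms unfolding Cc_infinity_def by blast

lemma Cc_infinity_continuous:
  assumes "\<phi> \<in> Cc_infinity n"
  shows "continuous_on UNIV \<phi>"
proof -
  have "Ck n 0 \<phi>" using assms unfolding Cc_infinity_def by blast
  then show ?thesis by simp
qed

lemma partial_deriv_outside:
  assumes "\<phi> \<in> Cc_infinity n" "j \<notin> {1..n}"
  shows "partial_deriv j \<phi> = (\<lambda>_. 0)"
proof
  fix x
  have "\<phi> (x(j := t)) = \<phi> x" for t
    using assms(2) by (intro Cc_infinity_dep[OF assms(1)]) auto
  then show "partial_deriv j \<phi> x = 0" by (simp add: partial_deriv_def)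
qed

lemma has_partial_deriv:
  assumes "\<phi> \<in> Cc_infinity n"
  shows "((\<lambda>t. \<phi> (x(j := t))) has_real_derivative partial_deriv j \<phi> x) (at (x j))"
proof (cases "j \<in> {1..n}")
  case True
  have "Ck n (Suc 0) \<phi>" using assms unfolding Cc_infinity_def by blast
  with True have "(\<lambda>t. \<phi> (x(j := t))) differentiable (at (x j))" by simp
  then show ?thesis
    by (simp add: partial_deriv_def DERIV_deriv_iff_real_differentiable)
next
  case False
  have "\<phi> (x(j := t)) = \<phi> x" for t
    using False by (intro Cc_infinity_dep[OF assms(1)]) auto
  then show ?thesis by (simp add: partial_deriv_outside[OF assms False])
qed

lemma Ck_zero: "Ck n k (\<lambda>_. 0)"
proof (induction k)
  case (Suc k)
  have "partial_deriv j (\<lambda>_. 0) = (\<lambda>_. 0)" for j by (simp add: partial_deriv_def fun_eq_iff)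
  with Suc show ?case by simp
qed simp

lemma Cc_infinity_partial_deriv:
  assumes \<phi>: "\<phi> \<in> Cc_infinity n"
  shows "partial_deriv j \<phi> \<in> Cc_infinity n"
proof (cases "j \<in> {1..n}")
  case False
  show ?thesis
    unfolding partial_deriv_outside[OF \<phi> False] by (auto simp: Cc_infinity_def Ck_zero)
next
  case True
  obtain R where R: "\<And>x i. \<phi> x \<noteq> 0 \<Longrightarrow> i \<in> {1..n} \<Longrightarrow> \<bar>x i\<bar> \<le> R"
    using \<phi> unfolding Cc_infinity_def by blast
  have "partial_deriv j \<phi> x = partial_deriv j \<phi> y" if "\<forall>i\<in>{1..n}. x i = y i" for x y
  proof -
    have "(\<lambda>t. \<phi> (x(j := t))) = (\<lambda>t. \<phi> (y(j := t)))"
      using that by (intro ext Cc_infinity_dep[OF \<phi>]) auto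
    with that True show ?thesis by (simp add: partial_deriv_def)
  qed
  moreover have "Ck n k (partial_deriv j \<phi>)" for k
  proof -
    have "Ck n (Suc k) \<phi>" using \<phi> unfolding Cc_infinity_def by blast
    with True show ?thesis by simp
  qed
  moreover have "\<bar>x i\<bar> \<le> R" if nz: "partial_deriv j \<phi> x \<noteq> 0" and i: "i \<in> {1..n}" for x i
  proof (rule ccontr)
    assume *: "\<not> \<bar>x i\<bar> \<le> R"
    \<comment> \<open>The bound \<open>R\<close> of \<phi> also serves its derivative: exceeding
      \<open>R\<close> in coordinate \<open>i\<close> persists for small moves along the j-th line,
      so \<phi> vanishes near \<open>x j\<close> on that line.\<close>
    have "\<forall>\<^sub>F t in nhds (x j). \<bar>(x(j := t)) i\<bar> > R"
    proof (cases "i = j")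
      case True
      have "open {t. \<bar>t\<bar> > R}" by (intro open_Collect_less continuous_intros)
      then show ?thesis using * True by (auto dest!: eventually_nhds_in_open[of _ "x j"])
    qed (use * in auto)
    then have "\<forall>\<^sub>F t in nhds (x j). \<phi> (x(j := t)) = 0"
      by (rule eventually_mono) (use R i in fastforce)
    then have "partial_deriv j \<phi> x = deriv (\<lambda>_. 0) (x j)"
      unfolding partial_deriv_def by (rule deriv_cong_ev) simp
    with nz show False by simp
  qed
  ultimately show ?thesis unfolding Cc_infinity_def by blast
qed

text \<open>The bound \<open>R\<close> leaves the coordinates beyond \<open>n\<close> free, so the
  support itself need not be compact in the sequence space. Setting those coordinates to 0 does not
  change \<phi>, and the resulting box is compact by Tychonoff's theorem.\<close>

lemma Cc_infinity_bounded:
  assumes \<phi>: "\<phi> \<in> Cc_infinity n"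
  obtains K where "\<And>x. \<bar>\<phi> x\<bar> \<le> K"
proof -
  obtain R where R: "\<And>x i. \<phi> x \<noteq> 0 \<Longrightarrow> i \<in> {1..n} \<Longrightarrow> \<bar>x i\<bar> \<le> R"
    using \<phi> unfolding Cc_infinity_def by blast
  define S where "S = PiE UNIV (\<lambda>i. if i \<in> {1..n} then {-R..R} else {0::real})"
  have "compactin (product_topology (\<lambda>i. euclidean) UNIV) S"
    unfolding S_def compactin_PiE by auto
  then have "compact S" by (simp add: euclidean_product_topology)
  then have "bounded (\<phi> ` S)"
    by (intro compact_imp_bounded compact_continuous_image
        continuous_on_subset[OF Cc_infinity_continuous[OF \<phi>]]) auto
  then obtain K where K: "\<And>x. x \<in> S \<Longrightarrow> \<bar>\<phi> x\<bar> \<le> K" by (auto simp: bounded_iff)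
  \<comment> \<open>The maximum covers the zeros of \<phi>: if \<open>R\<close> is negative the box
    can be empty, and then \<open>K\<close> need not be nonnegative.\<close>
  have "\<bar>\<phi> x\<bar> \<le> max K 0" for x
  proof (cases "\<phi> x = 0")
    case False
    let ?y = "\<lambda>i. if i \<in> {1..n} then x i else 0"
    have "\<phi> x = \<phi> ?y" by (rule Cc_infinity_dep[OF \<phi>]) auto
    moreover have "?y \<in> S"
      unfolding S_def using R[OF False] by (auto simp: PiE_iff abs_le_iff minus_le_iff)
    ultimately show ?thesis using K[of ?y] by simp
  qed simp
  then show ?thesis by (rule that)
qed

lemma partial_deriv_commute:
  assumes \<phi>: "\<phi> \<in> Cc_infinity n"
  shows "partial_deriv i (partial_deriv j \<phi>) x = partial_deriv j (partial_deriv i \<phi>) x"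
proof (cases "i = j")
  case False
  \<comment> \<open>The plane through \<open>x\<close> in the directions \<open>j\<close> and
    \<open>i\<close>, which passes through \<open>x\<close> at \<open>p (x j) (x i)\<close>.\<close>
  define p where "p s t = x(j := s, i := t)" for s t
  have pd: "((\<lambda>s. \<psi> (p s t)) has_real_derivative partial_deriv j \<psi> (p s t)) (at s)"
    "((\<lambda>t. \<psi> (p s t)) has_real_derivative partial_deriv i \<psi> (p s t)) (at t)"
    if "\<psi> \<in> Cc_infinity n" for \<psi> s t
    using has_partial_deriv[OF that, of "p s t" j] has_partial_deriv[OF that, of "p s t" i] False
    by (simp_all add: p_def fun_upd_twist)
  have cont: "isCont (\<lambda>(s, t). \<psi> (p s t)) q" if "\<psi> \<in> Cc_infinity n" for \<psi> q
  proof -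
    have "continuous_on UNIV (\<lambda>q. p (fst q) (snd q))"
    proof (rule continuous_on_coordinatewise_then_product)
      show "continuous_on UNIV (\<lambda>q. p (fst q) (snd q) k)" for k
        unfolding p_def by (cases "k = i"; cases "k = j") (auto intro!: continuous_intros)
    qed
    then have "continuous_on UNIV (\<lambda>q. \<psi> (p (fst q) (snd q)))"
      by (rule continuous_on_compose2[OF Cc_infinity_continuous[OF that]]) auto
    then show ?thesis by (simp add: continuous_on_eq_continuous_at case_prod_unfold del: split_paired_All)
  qed
  note D = Cc_infinity_partial_deriv
  have "partial_deriv i (partial_deriv j \<phi>) (p (x j) (x i)) =
      partial_deriv j (partial_deriv i \<phi>) (p (x j) (x i))"
    by (rule mixed_derivatives_eq[of "\<lambda>s t. \<phi> (p s t)"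
          "\<lambda>s t. partial_deriv j \<phi> (p s t)" "\<lambda>s t. partial_deriv i \<phi> (p s t)"])
       (intro pd cont D \<phi>)+
  then show ?thesis by (simp add: p_def)
qed simp


section \<open>Coordinates of the vector field\<close>

definition conj_index :: "nat \<Rightarrow> nat" where
  "conj_index k = (if even k then k - 1 else k + 1)"

text \<open>The sign is attached to the target of \<open>J\<close>, not to the source:
  \<open>J (e j)\<close> carries the sign of \<open>conj_index j\<close>, so the k-th coordinate of
  the vector field carries \<open>conj_sign k\<close>.\<close>

definition conj_sign :: "nat \<Rightarrow> real" where
  "conj_sign k = (if even k then 1 else - 1)"

lemma conj_index_pos: "k \<ge> 1 \<Longrightarrow> conj_index k \<ge> 1"
  and conj_index_involution[simp]: "k \<ge> 1 \<Longrightarrow> conj_index (conj_index k) = k"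
  and conj_sign_conj_index[simp]: "k \<ge> 1 \<Longrightarrow> conj_sign (conj_index k) = - conj_sign k"
  by (auto simp: conj_index_def conj_sign_def elim!: evenE)

lemma conj_index_eq_iff: "j \<ge> 1 \<Longrightarrow> k \<ge> 1 \<Longrightarrow> conj_index j = k \<longleftrightarrow> j = conj_index k"
  using conj_index_involution by metis

lemma symplectic_operator_basis:
  assumes "symplectic_operator e J" "j \<ge> 1"
  shows "J (e j) = conj_sign (conj_index j) *\<^sub>R e (conj_index j)"
proof -
  have J: "J (e (2 * i - 1)) = e (2 * i)" "J (e (2 * i)) = - e (2 * i - 1)" if "i \<ge> 1" for i
    using assms(1) that unfolding symplectic_operator_def by blast+
  show ?thesis
  proof (cases "even j")
    case True
    then obtain i where "j = 2 * i" by (rule evenE)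
    with J(2)[of i] assms(2) show ?thesis by (auto simp: conj_index_def conj_sign_def)
  next
    case False
    then obtain i where "j = 2 * i + 1" by (rule oddE)
    with J(1)[of "i + 1"] show ?thesis by (auto simp: conj_index_def conj_sign_def)
  qed
qed

section \<open>Norms of finite combinations and functionals on the weighted space\<close>

locale weighted_basis =
  fixes e :: "nat \<Rightarrow> 'h::real_inner" and \<alpha> :: "nat \<Rightarrow> real"
  assumes orthonormal: "i \<ge> 1 \<Longrightarrow> j \<ge> 1 \<Longrightarrow> e i \<bullet> e j = (if i = j then 1 else 0)"
    and \<alpha>_pos: "j \<ge> 1 \<Longrightarrow> \<alpha> j > 0"
begin

lemma inner_finite_sum:
  assumes "finite B" "B \<subseteq> {1..}" "j \<ge> 1"
  shows "(\<Sum>k\<in>B. c k *\<^sub>R e k) \<bullet> e j = (if j \<in> B then c j else 0)"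
proof -
  have "(\<Sum>k\<in>B. c k *\<^sub>R e k) \<bullet> e j = (\<Sum>k\<in>B. if k = j then c k else 0)"
    unfolding inner_sum_left using assms orthonormal by (intro sum.cong) (auto simp: subset_iff)
  with assms show ?thesis by simp
qed

lemma finite_sum_Hplus:
  assumes B: "finite B" "B \<subseteq> {1..}"
  shows "(\<Sum>k\<in>B. c k *\<^sub>R e k) \<in> Hplus e \<alpha>"
    and "Hplus_norm e \<alpha> (\<Sum>k\<in>B. c k *\<^sub>R e k) = sqrt (\<Sum>k\<in>B. \<alpha> k * (c k)\<^sup>2)"
proof -
  note i = inner_finite_sum[OF B]
  have "(\<lambda>j. \<alpha> j * ((\<Sum>k\<in>B. c k *\<^sub>R e k) \<bullet> e j)\<^sup>2) summable_on {1..} \<longleftrightarrow>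
      (\<lambda>j. \<alpha> j * (c j)\<^sup>2) summable_on B"
    using B by (intro summable_on_cong_neutral) (auto simp: i)
  then show "(\<Sum>k\<in>B. c k *\<^sub>R e k) \<in> Hplus e \<alpha>"
    using B by (simp add: Hplus_def)
  have "Hplus_inner e \<alpha> (\<Sum>k\<in>B. c k *\<^sub>R e k) (\<Sum>k\<in>B. c k *\<^sub>R e k) = (\<Sum>\<^sub>\<infinity>k\<in>B. \<alpha> k * (c k)\<^sup>2)"
    unfolding Hplus_inner_def using B
    by (intro infsum_cong_neutral) (auto simp: i inner_commute[of "e _"] power2_eq_square)
  with B show "Hplus_norm e \<alpha> (\<Sum>k\<in>B. c k *\<^sub>R e k) = sqrt (\<Sum>k\<in>B. \<alpha> k * (c k)\<^sup>2)"
    by (simp add: Hplus_norm_def)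
qed

lemma basis_Hplus: "k \<ge> 1 \<Longrightarrow> e k \<in> Hplus e \<alpha>"
  using finite_sum_Hplus(1)[of "{k}" "\<lambda>_. 1"] by simp

text \<open>This evaluates the pairing with a gradient from the coordinates \<open>l (e k)\<close>.
  Linearity of \<open>l\<close> is available on \<open>Hplus\<close> only, so every partial sum has
  to be placed there.\<close>

lemma Hminus_finite_sum:
  assumes l: "l \<in> Hminus e \<alpha>" and "finite B" "B \<subseteq> {1..}"
  shows "l (\<Sum>k\<in>B. c k *\<^sub>R e k) = (\<Sum>k\<in>B. c k * l (e k))"
  using assms(2,3)
proof (induction B rule: finite_induct)
  case empty
  have "0 \<in> Hplus e \<alpha>" using finite_sum_Hplus(1)[of "{}"] by simp
  then have "l (0 *\<^sub>R 0) = 0 * l 0" using l unfolding Hminus_def by blast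
  then show ?case by simp
next
  case (insert a B)
  have 1: "(\<Sum>k\<in>B. c k *\<^sub>R e k) \<in> Hplus e \<alpha>" using insert finite_sum_Hplus by auto
  have 2: "e a \<in> Hplus e \<alpha>" using insert basis_Hplus by auto
  have 3: "c a *\<^sub>R e a \<in> Hplus e \<alpha>" using insert finite_sum_Hplus(1)[of "{a}" c] by auto
  have "l (c a *\<^sub>R e a + (\<Sum>k\<in>B. c k *\<^sub>R e k)) = l (c a *\<^sub>R e a) + l (\<Sum>k\<in>B. c k *\<^sub>R e k)"
    using l 1 3 unfolding Hminus_def by blast
  moreover have "l (c a *\<^sub>R e a) = c a * l (e a)" using l 2 unfolding Hminus_def by blast
  ultimately show ?case using insert by simp
qed

text \<open>Testing \<open>l\<close> on its own truncated Riesz representative bounds the partial sums by the square of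
  its operator norm. So the infinite sum in \<open>Hminus_norm\<close> is never the junk value 0 on \<open>Hminus\<close>.\<close>

lemma Hminus_summable:
  assumes l: "l \<in> Hminus e \<alpha>"
  shows "(\<lambda>j. inverse (\<alpha> j) * (l (e j))\<^sup>2) summable_on {1..}"
proof (rule nonneg_bdd_above_summable_on)
  show "0 \<le> inverse (\<alpha> j) * (l (e j))\<^sup>2" if "j \<in> {1..}" for j
    using \<alpha>_pos[of j] that by simp
  obtain C where C: "\<And>u. u \<in> Hplus e \<alpha> \<Longrightarrow> \<bar>l u\<bar> \<le> C * Hplus_norm e \<alpha> u"
    using l unfolding Hminus_def by blast
  show "bdd_above (sum (\<lambda>j. inverse (\<alpha> j) * (l (e j))\<^sup>2) ` {F. F \<subseteq> {1..} \<and> finite F})"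
  proof (rule bdd_aboveI2)
    fix B :: "nat set" assume "B \<in> {F. F \<subseteq> {1..} \<and> finite F}"
    then have B: "finite B" "B \<subseteq> {1..}" by auto
    define S where "S = (\<Sum>j\<in>B. inverse (\<alpha> j) * (l (e j))\<^sup>2)"
    \<comment> \<open>With these coefficients the value of \<open>l\<close> and the squared
      \<open>Hplus_norm\<close> are both \<open>S\<close>, so boundedness of \<open>l\<close> reads
      \<open>S \<le> C * sqrt S\<close>.\<close>
    define c where "c j = inverse (\<alpha> j) * l (e j)" for j
    have "\<alpha> k * (c k)\<^sup>2 = inverse (\<alpha> k) * (l (e k))\<^sup>2" if "k \<in> B" for k
      using \<alpha>_pos[of k] B that by (auto simp: c_def power2_eq_square field_simps)
    then have nrm: "Hplus_norm e \<alpha> (\<Sum>k\<in>B. c k *\<^sub>R e k) = sqrt S"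
      unfolding finite_sum_Hplus(2)[OF B] S_def by simp
    have "l (\<Sum>k\<in>B. c k *\<^sub>R e k) = S"
      unfolding Hminus_finite_sum[OF l B] S_def
      by (intro sum.cong) (auto simp: c_def power2_eq_square)
    then have le: "S \<le> C * sqrt S"
      using C[OF finite_sum_Hplus(1)[OF B], of c] nrm by simp
    have S0: "S \<ge> 0" unfolding S_def using \<alpha>_pos B by (intro sum_nonneg) (auto simp: less_imp_le subset_iff)
    show "S \<le> C\<^sup>2"
    proof (cases "S = 0")
      case False
      with S0 have "sqrt S > 0" by simp
      moreover have "sqrt S * sqrt S \<le> C * sqrt S" using le S0 by simp
      ultimately have "sqrt S \<le> C" by (simp only: mult_le_cancel_right_pos)
      then have "(sqrt S)\<^sup>2 \<le> C\<^sup>2" using S0 by (intro power_mono) auto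
      with S0 show ?thesis by simp
    qed simp
  qed
qed

text \<open>One term of a nonnegative series is at most its sum. Assuming summability rather than
  membership in \<open>Hminus\<close> lets this apply directly to the truncation errors of the
  vector field.\<close>

lemma Hminus_norm_coordinate:
  assumes "(\<lambda>j. inverse (\<alpha> j) * (l (e j))\<^sup>2) summable_on {1..}" "k \<ge> 1"
  shows "inverse (\<alpha> k) * (l (e k))\<^sup>2 \<le> (Hminus_norm e \<alpha> l)\<^sup>2"
proof -
  have nn: "0 \<le> inverse (\<alpha> j) * (l (e j))\<^sup>2" if "j \<in> {1..}" for j
    using \<alpha>_pos[of j] that by simp
  have "(\<Sum>j\<in>{k}. inverse (\<alpha> j) * (l (e j))\<^sup>2) \<le> (\<Sum>\<^sub>\<infinity>j\<in>{1..}. inverse (\<alpha> j) * (l (e j))\<^sup>2)"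
    using assms nn by (intro finite_sum_le_infsum) auto
  moreover have "0 \<le> (\<Sum>\<^sub>\<infinity>j\<in>{1..}. inverse (\<alpha> j) * (l (e j))\<^sup>2)"
    using nn by (rule infsum_nonneg)
  ultimately show ?thesis by (simp add: Hminus_norm_def)
qed

lemma Hminus_diff:
  assumes "k \<in> Hminus e \<alpha>" "l \<in> Hminus e \<alpha>"
  shows "(\<lambda>v. k v - l v) \<in> Hminus e \<alpha>"
proof -
  obtain C where C: "\<And>u. u \<in> Hplus e \<alpha> \<Longrightarrow> \<bar>k u\<bar> \<le> C * Hplus_norm e \<alpha> u"
    using assms(1) unfolding Hminus_def by blast
  obtain D where D: "\<And>u. u \<in> Hplus e \<alpha> \<Longrightarrow> \<bar>l u\<bar> \<le> D * Hplus_norm e \<alpha> u"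
    using assms(2) unfolding Hminus_def by blast
  have "\<bar>k u - l u\<bar> \<le> (C + D) * Hplus_norm e \<alpha> u" if "u \<in> Hplus e \<alpha>" for u
    using C[OF that] D[OF that] by (simp add: distrib_right)
  then have 1: "\<exists>C. \<forall>u\<in>Hplus e \<alpha>. \<bar>k u - l u\<bar> \<le> C * Hplus_norm e \<alpha> u" by blast
  have 2: "k (u + v) - l (u + v) = (k u - l u) + (k v - l v)"
    if "u \<in> Hplus e \<alpha>" "v \<in> Hplus e \<alpha>" for u v
  proof -
    have "k (u + v) = k u + k v" "l (u + v) = l u + l v"
      using assms that unfolding Hminus_def by blast+
    then show ?thesis by simp
  qed
  have 3: "k (c *\<^sub>R u) - l (c *\<^sub>R u) = c * (k u - l u)" if "u \<in> Hplus e \<alpha>" for c u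
  proof -
    have "k (c *\<^sub>R u) = c * k u" "l (c *\<^sub>R u) = c * l u"
      using assms that unfolding Hminus_def by blast+
    then show ?thesis by (simp add: right_diff_distrib)
  qed
  have 4: "k u - l u = 0" if "u \<notin> Hplus e \<alpha>" for u
  proof -
    have "k u = 0" "l u = 0" using assms that unfolding Hminus_def by blast+
    then show ?thesis by simp
  qed
  from 1 2 3 4 show ?thesis
    unfolding Hminus_def mem_Collect_eq by (intro conjI ballI allI impI) assumption+
qed

section \<open>Measurable coordinates on the dual space and their values on the vector field\<close>

lemma space_Hminus_borel: "space (Hminus_borel e \<alpha>) = Hminus e \<alpha>"
  unfolding Hminus_borel_def by (rule space_measure_of) auto

text \<open>Evaluation at \<open>e k\<close> is Lipschitz for \<open>Hminus_norm\<close> with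
  constant \<open>sqrt (\<alpha> k)\<close>. Preimages of open sets are thus open and belong to the
  generator of the sigma-algebra; the radius \<open>r\<close> below is \<epsilon> divided by that
  constant.\<close>

lemma coordinate_measurable:
  assumes k: "k \<ge> 1"
  shows "(\<lambda>l. l (e k)) \<in> borel_measurable (Hminus_borel e \<alpha>)"
proof (rule borel_measurableI)
  fix S :: "real set" assume "open S"
  let ?U = "(\<lambda>l. l (e k)) -` S \<inter> Hminus e \<alpha>"
  have "\<exists>r>0. \<forall>m\<in>Hminus e \<alpha>. Hminus_norm e \<alpha> (\<lambda>v. m v - l v) < r \<longrightarrow> m \<in> ?U" if l: "l \<in> ?U" for l
  proof -
    obtain \<epsilon> where \<epsilon>: "\<epsilon> > 0" "\<And>y. dist y (l (e k)) < \<epsilon> \<Longrightarrow> y \<in> S"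
      using \<open>open S\<close> l unfolding open_dist by blast
    have a: "\<alpha> k > 0" using \<alpha>_pos k by simp
    define r where "r = \<epsilon> / sqrt (\<alpha> k)"
    have r: "r > 0" using \<epsilon> a by (simp add: r_def)
    have "m \<in> ?U" if m: "m \<in> Hminus e \<alpha>" "Hminus_norm e \<alpha> (\<lambda>v. m v - l v) < r" for m
    proof -
      have d: "(\<lambda>v. m v - l v) \<in> Hminus e \<alpha>"
        by (rule Hminus_diff[OF m(1)]) (use l in blast)
      have "0 \<le> Hminus_norm e \<alpha> (\<lambda>v. m v - l v)"
        unfolding Hminus_norm_def using \<alpha>_pos by (intro real_sqrt_ge_zero infsum_nonneg) (simp add: less_imp_le)
      then have "(Hminus_norm e \<alpha> (\<lambda>v. m v - l v))\<^sup>2 < r\<^sup>2"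
        using m(2) by (intro power_strict_mono) auto
      with Hminus_norm_coordinate[OF Hminus_summable[OF d] k]
      have "inverse (\<alpha> k) * (m (e k) - l (e k))\<^sup>2 < r\<^sup>2" by simp
      also have "r\<^sup>2 = inverse (\<alpha> k) * \<epsilon>\<^sup>2" using a by (simp add: r_def power_divide field_simps)
      finally have "(m (e k) - l (e k))\<^sup>2 < \<epsilon>\<^sup>2" using a by simp
      then have "\<bar>m (e k) - l (e k)\<bar>\<^sup>2 < \<epsilon>\<^sup>2" by simp
      then have "\<bar>m (e k) - l (e k)\<bar> < \<epsilon>" using \<epsilon>(1) by (rule power2_less_imp_less[OF _ less_imp_le])
      then have "m (e k) \<in> S" by (intro \<epsilon>(2)) (simp add: dist_real_def)
      with m(1) show ?thesis by blast
    qed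
    then show ?thesis using r by (intro exI[of _ r] conjI ballI impI)
  qed
  then have "?U \<in> {U. U \<subseteq> Hminus e \<alpha> \<and> (\<forall>l\<in>U. \<exists>r>0. \<forall>m\<in>Hminus e \<alpha>.
      Hminus_norm e \<alpha> (\<lambda>v. m v - l v) < r \<longrightarrow> m \<in> U)}" (is "_ \<in> ?A")
    by (intro CollectI conjI ballI Int_lower2)
  moreover have "?A \<subseteq> Pow (Hminus e \<alpha>)" by blast
  ultimately show "(\<lambda>l. l (e k)) -` S \<inter> space (Hminus_borel e \<alpha>) \<in> sets (Hminus_borel e \<alpha>)"
    unfolding space_Hminus_borel unfolding Hminus_borel_def
    by (simp only: sets_measure_of sigma_sets.Basic)
qed

lemma vector_field_values:
  assumes X: "is_vector_field M W e \<alpha> J X" and "\<omega> \<in> space M"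
  shows "X \<omega> \<in> Hminus e \<alpha>"
proof -
  have "X \<in> M \<rightarrow>\<^sub>M Hminus_borel e \<alpha>" using X by (auto simp: is_vector_field_def L2_Hminus_def)
  from measurable_space[OF this assms(2)] show ?thesis by (simp add: space_Hminus_borel)
qed

lemma vector_field_coordinate_measurable:
  assumes X: "is_vector_field M W e \<alpha> J X" and "k \<ge> 1"
  shows "(\<lambda>\<omega>. X \<omega> (e k)) \<in> borel_measurable M"
proof -
  have "X \<in> M \<rightarrow>\<^sub>M Hminus_borel e \<alpha>" using X by (auto simp: is_vector_field_def L2_Hminus_def)
  from measurable_comp[OF this coordinate_measurable[OF assms(2)]] show ?thesis by (simp add: comp_def)
qed

text \<open>Once \<open>n\<close> reaches \<open>conj_index k\<close>, the k-th coordinate of the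
  partial sums no longer changes. The fixed nonnegative function \<open>d\<close> is then dominated
  by squared truncation errors whose integrals tend to 0, so it vanishes almost everywhere.\<close>

lemma vector_field_coordinate:
  assumes X: "is_vector_field M W e \<alpha> J X" and J: "symplectic_operator e J" and k: "k \<ge> 1"
    and W: "W (e (conj_index k)) \<in> borel_measurable M"
  shows "AE \<omega> in M. X \<omega> (e k) = conj_sign k * W (e (conj_index k)) \<omega>"
proof -
  define h where "h n \<omega> = (\<Sum>j=1..n. W (e j) \<omega> *\<^sub>R J (e j))" for n \<omega>
  define Y where "Y n \<omega> = (\<lambda>v. X \<omega> v - Hminus_embed e \<alpha> (h n \<omega>) v)" for n \<omega>
  have h: "h n \<omega> \<bullet> e i = (if conj_index i \<le> n then conj_sign i * W (e (conj_index i)) \<omega> else 0)"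
    if i: "i \<ge> 1" for n \<omega> i
  proof -
    have "h n \<omega> \<bullet> e i = (\<Sum>j=1..n. if j = conj_index i then conj_sign i * W (e (conj_index i)) \<omega> else 0)"
      unfolding h_def inner_sum_left
    proof (rule sum.cong[OF refl])
      fix j assume "j \<in> {1..n}"
      then have j: "j \<ge> 1" by simp
      have "J (e j) \<bullet> e i = conj_sign (conj_index j) * (if conj_index j = i then 1 else 0)"
        unfolding symplectic_operator_basis[OF J j] inner_scaleR_left
        using orthonormal[OF conj_index_pos[OF j] i] by simp
      then show "W (e j) \<omega> *\<^sub>R J (e j) \<bullet> e i =
          (if j = conj_index i then conj_sign i * W (e (conj_index i)) \<omega> else 0)"
        unfolding inner_scaleR_left using conj_index_eq_iff[OF j i] by auto
    qed
    also have "\<dots> = (if conj_index i \<le> n then conj_sign i * W (e (conj_index i)) \<omega> else 0)"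
      using conj_index_pos[OF i] by simp
    finally show ?thesis .
  qed
  have Ye: "Y n \<omega> (e i) = X \<omega> (e i) - h n \<omega> \<bullet> e i" if "i \<ge> 1" for n \<omega> i
    using basis_Hplus[OF that] by (simp add: Y_def Hminus_embed_def)
  \<comment> \<open>Without summability the norm of the truncation error could be the default value
    0 and bound nothing. The error is a difference of a summable part from \<open>X\<close> and a
    part with finitely many nonzero coordinates.\<close>
  have Ysum: "(\<lambda>j. inverse (\<alpha> j) * (Y n \<omega> (e j))\<^sup>2) summable_on {1..}" if "\<omega> \<in> space M" for n \<omega>
  proof -
    have fin: "finite {j \<in> {1..}. conj_index j \<le> n}"
      \<comment> \<open>\<open>conj_index\<close> moves an index by at most one, hence
        \<open>n + 1\<close>.\<close>
      by (rule finite_subset[of _ "{..n + 1}"]) (auto simp: conj_index_def split: if_splits)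
    have "(\<lambda>j. inverse (\<alpha> j) * (h n \<omega> \<bullet> e j)\<^sup>2) summable_on {1..}"
      by (rule finite_nonzero_values_imp_summable_on)
         (rule finite_subset[OF _ fin], auto simp: h split: if_splits)
    then have "(\<lambda>j. 2 * (inverse (\<alpha> j) * (X \<omega> (e j))\<^sup>2 + inverse (\<alpha> j) * (h n \<omega> \<bullet> e j)\<^sup>2)) summable_on {1..}"
      using Hminus_summable[OF vector_field_values[OF X that]]
      by (intro summable_on_cmult_right summable_on_add)
    then show ?thesis
    proof (rule summable_on_comparison_test)
      fix j :: nat assume j: "j \<in> {1..}"
      then have p: "0 \<le> inverse (\<alpha> j)" using \<alpha>_pos[of j] by simp
      show "0 \<le> inverse (\<alpha> j) * (Y n \<omega> (e j))\<^sup>2" using p by simp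
      have "(X \<omega> (e j) - h n \<omega> \<bullet> e j)\<^sup>2 \<le> 2 * ((X \<omega> (e j))\<^sup>2 + (h n \<omega> \<bullet> e j)\<^sup>2)"
        using zero_le_power2[of "X \<omega> (e j) + h n \<omega> \<bullet> e j"] by (simp add: power2_eq_square algebra_simps)
      from mult_left_mono[OF this p] show "inverse (\<alpha> j) * (Y n \<omega> (e j))\<^sup>2
          \<le> 2 * (inverse (\<alpha> j) * (X \<omega> (e j))\<^sup>2 + inverse (\<alpha> j) * (h n \<omega> \<bullet> e j)\<^sup>2)"
        using j by (simp add: Ye algebra_simps)
    qed
  qed
  define d where "d \<omega> = inverse (\<alpha> k) * (X \<omega> (e k) - conj_sign k * W (e (conj_index k)) \<omega>)\<^sup>2" for \<omega>
  have d0: "0 \<le> d \<omega>" for \<omega> using \<alpha>_pos[OF k] by (simp add: d_def)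
  have le: "(\<integral>\<^sup>+\<omega>. ennreal (d \<omega>) \<partial>M) \<le> (\<integral>\<^sup>+\<omega>. ennreal ((Hminus_norm e \<alpha> (Y n \<omega>))\<^sup>2) \<partial>M)"
    if "conj_index k \<le> n" for n
  proof (intro nn_integral_mono ennreal_leI)
    fix \<omega> assume "\<omega> \<in> space M"
    moreover have "Y n \<omega> (e k) = X \<omega> (e k) - conj_sign k * W (e (conj_index k)) \<omega>"
      using that by (simp add: Ye[OF k] h[OF k])
    ultimately show "d \<omega> \<le> (Hminus_norm e \<alpha> (Y n \<omega>))\<^sup>2"
      using Hminus_norm_coordinate[OF Ysum k] unfolding d_def by metis
  qed
  have lim: "(\<lambda>n. \<integral>\<^sup>+\<omega>. ennreal ((Hminus_norm e \<alpha> (Y n \<omega>))\<^sup>2) \<partial>M) \<longlonglongrightarrow> 0"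
    using X unfolding is_vector_field_def Y_def h_def by blast
  have "(\<integral>\<^sup>+\<omega>. ennreal (d \<omega>) \<partial>M) \<le> 0"
    by (rule LIMSEQ_le_const[OF lim]) (use le in blast)
  moreover have [measurable]: "d \<in> borel_measurable M"
    unfolding d_def using vector_field_coordinate_measurable[OF X k] W by measurable
  ultimately have "AE \<omega> in M. ennreal (d \<omega>) = 0"
    by (subst (asm) le_zero_eq, subst (asm) nn_integral_0_iff_AE) auto
  then show ?thesis
  proof eventually_elim
    case (elim \<omega>)
    then have "d \<omega> = 0" using d0[of \<omega>] by (simp add: ennreal_eq_0_iff)
    then show ?case using \<alpha>_pos[OF k] by (simp add: d_def)
  qed
qed

end


section \<open>The KMS identity\<close>

context gaussian_space
begin

lemma bounded_continuous_integrable: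
  fixes f :: "(nat \<Rightarrow> real) \<Rightarrow> real"
  assumes cont: "continuous_on UNIV f" and bound: "\<And>x. \<bar>f x\<bar> \<le> K"
  shows "integrable M (\<lambda>\<omega>. f (\<lambda>i. W (e i) \<omega>))"
    and "integrable M (\<lambda>\<omega>. W g \<omega> * f (\<lambda>i. W (e i) \<omega>))"
proof -
  have [measurable]: "(\<lambda>\<omega>. f (\<lambda>i. W (e i) \<omega>)) \<in> borel_measurable M"
    by (rule continuous_W_measurable[OF cont])
  show "integrable M (\<lambda>\<omega>. f (\<lambda>i. W (e i) \<omega>))"
    using bound by (intro integrable_const_bound[of _ K]) auto
  show "integrable M (\<lambda>\<omega>. W g \<omega> * f (\<lambda>i. W (e i) \<omega>))"
  proof (rule Bochner_Integration.integrable_bound)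
    show "integrable M (\<lambda>\<omega>. W g \<omega> * K)" by simp
    show "AE \<omega> in M. norm (W g \<omega> * f (\<lambda>i. W (e i) \<omega>)) \<le> norm (W g \<omega> * K)"
      by (auto simp: abs_mult intro!: mult_left_mono AE_I2 order_trans[OF bound abs_ge_self])
  qed measurable
qed

lemma Cc_infinity_mult_integrable:
  assumes "\<phi> \<in> Cc_infinity n" "\<psi> \<in> Cc_infinity m"
  shows "integrable M (\<lambda>\<omega>. \<phi> (\<lambda>i. W (e i) \<omega>) * \<psi> (\<lambda>i. W (e i) \<omega>))"
    and "integrable M (\<lambda>\<omega>. W g \<omega> * (\<phi> (\<lambda>i. W (e i) \<omega>) * \<psi> (\<lambda>i. W (e i) \<omega>)))"
proof -
  obtain K L where "\<And>x. \<bar>\<phi> x\<bar> \<le> K" "\<And>x. \<bar>\<psi> x\<bar> \<le> L"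
    using Cc_infinity_bounded assms by metis
  then have b: "\<bar>\<phi> x * \<psi> x\<bar> \<le> K * L" for x
    by (simp add: abs_mult mult_mono' order_trans[OF abs_ge_zero])
  have c: "continuous_on UNIV (\<lambda>x. \<phi> x * \<psi> x)"
    using assms by (intro continuous_intros Cc_infinity_continuous)
  show "integrable M (\<lambda>\<omega>. \<phi> (\<lambda>i. W (e i) \<omega>) * \<psi> (\<lambda>i. W (e i) \<omega>))"
    "integrable M (\<lambda>\<omega>. W g \<omega> * (\<phi> (\<lambda>i. W (e i) \<omega>) * \<psi> (\<lambda>i. W (e i) \<omega>)))"
    using bounded_continuous_integrable[OF c b] by simp_all
qed

lemma Cc_infinity_integration_by_parts:
  assumes on: "\<And>i j. i \<ge> 1 \<Longrightarrow> j \<ge> 1 \<Longrightarrow> e i \<bullet> e j = (if i = j then 1 else 0)"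
    and \<phi>: "\<phi> \<in> Cc_infinity n" and \<psi>: "\<psi> \<in> Cc_infinity m" and j: "j \<ge> 1"
  defines "V \<equiv> \<lambda>\<omega> i. W (e i) \<omega>"
  shows "(\<integral>\<omega>. W (e j) \<omega> * (\<phi> (V \<omega>) * \<psi> (V \<omega>)) \<partial>M) =
    (\<integral>\<omega>. partial_deriv j \<phi> (V \<omega>) * \<psi> (V \<omega>) \<partial>M) + (\<integral>\<omega>. \<phi> (V \<omega>) * partial_deriv j \<psi> (V \<omega>) \<partial>M)"
proof -
  define f where "f x = \<phi> x * \<psi> x" for x
  define f' where "f' x = partial_deriv j \<phi> x * \<psi> x + \<phi> x * partial_deriv j \<psi> x" for x
  note d\<phi> = Cc_infinity_partial_deriv[OF \<phi>, of j] and d\<psi> = Cc_infinity_partial_deriv[OF \<psi>, of j]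
  obtain K L K' L' where K: "\<And>x. \<bar>\<phi> x\<bar> \<le> K" "\<And>x. \<bar>\<psi> x\<bar> \<le> L"
    "\<And>x. \<bar>partial_deriv j \<phi> x\<bar> \<le> K'" "\<And>x. \<bar>partial_deriv j \<psi> x\<bar> \<le> L'"
    using Cc_infinity_bounded \<phi> \<psi> d\<phi> d\<psi> by metis
  have nn: "0 \<le> K" "0 \<le> L" "0 \<le> K'" "0 \<le> L'"
    using K order_trans[OF abs_ge_zero] by blast+
  have b1: "\<bar>f x\<bar> \<le> K * L" for x
    unfolding f_def abs_mult using K nn by (intro mult_mono) auto
  have "\<bar>f' x\<bar> \<le> \<bar>partial_deriv j \<phi> x\<bar> * \<bar>\<psi> x\<bar> + \<bar>\<phi> x\<bar> * \<bar>partial_deriv j \<psi> x\<bar>" for x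
    unfolding f'_def abs_mult[symmetric] by (rule abs_triangle_ineq)
  also have "\<dots> x \<le> K' * L + K * L'" for x
    using K nn by (intro add_mono mult_mono) auto
  finally have b2: "\<bar>f' x\<bar> \<le> K' * L + K * L'" for x .
  have "(\<integral>\<omega>. f' (\<lambda>i. W (e i) \<omega>) \<partial>M) = (\<integral>\<omega>. W (e j) \<omega> * f (\<lambda>i. W (e i) \<omega>) \<partial>M)"
  \<comment> \<open>The index set \<open>{1..}\<close> contains the variables of both functions and
    also \<open>j\<close>, which may exceed \<open>n\<close> and \<open>m\<close>.\<close>
  proof (rule gaussian_integration_by_parts[of "{1..}"])
    show "continuous_on UNIV f" "continuous_on UNIV f'"
      unfolding f_def f'_def
      by (intro continuous_intros Cc_infinity_continuous[OF \<phi>] Cc_infinity_continuous[OF \<psi>]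
          Cc_infinity_continuous[OF d\<phi>] Cc_infinity_continuous[OF d\<psi>])+
    show "\<bar>f x\<bar> \<le> max (K * L) (K' * L + K * L')" "\<bar>f' x\<bar> \<le> max (K * L) (K' * L + K * L')" for x
      using b1[of x] b2[of x] by auto
    show "f x = f y \<and> f' x = f' y" if "\<And>i. i \<in> {1..} \<Longrightarrow> x i = y i" for x y
    proof -
      have "\<phi> x = \<phi> y" "\<psi> x = \<psi> y" "partial_deriv j \<phi> x = partial_deriv j \<phi> y"
        "partial_deriv j \<psi> x = partial_deriv j \<psi> y"
        using that by (auto intro!: Cc_infinity_dep[OF \<phi>] Cc_infinity_dep[OF \<psi>] Cc_infinity_dep[OF d\<phi>] Cc_infinity_dep[OF d\<psi>])
      then show ?thesis by (simp add: f_def f'_def)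
    qed
    show "((\<lambda>t. f (x(j := t))) has_real_derivative f' x) (at (x j))" for x
      using DERIV_mult[OF has_partial_deriv[OF \<phi>, of x j] has_partial_deriv[OF \<psi>, of x j]]
      by (simp add: f_def f'_def mult.commute add.commute)
  qed (use on j in auto)
  then show ?thesis
    unfolding f_def f'_def V_def
    using Cc_infinity_mult_integrable(1)[OF d\<phi> \<psi>] Cc_infinity_mult_integrable(1)[OF \<phi> d\<psi>] by simp
qed

end

text \<open>Symmetry of the mixed derivatives makes the pairs \<open>k\<close>, \<open>conj_index k\<close> cancel; an unpaired \<open>k = n\<close>
  contributes 0 because \<open>\<phi>\<close> does not depend on the coordinate \<open>n + 1\<close>.\<close>

lemma sum_conj_derivatives_zero:
  fixes \<phi> :: "(nat \<Rightarrow> real) \<Rightarrow> real"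
  assumes \<phi>: "\<phi> \<in> Cc_infinity n"
  shows "(\<Sum>k=1..n. conj_sign k * partial_deriv (conj_index k) (partial_deriv k \<phi>) x) = 0"
proof -
  define T where "T k = conj_sign k * partial_deriv (conj_index k) (partial_deriv k \<phi>) x" for k
  define D where "D = {k \<in> {1..n}. conj_index k \<in> {1..n}}"
  have T: "T (conj_index k) = - T k" if "k \<ge> 1" for k
    using that partial_deriv_commute[OF \<phi>] by (simp add: T_def)
  have "(\<Sum>k=1..n. T k) = sum T D"
    unfolding D_def
    by (intro sum.mono_neutral_right)
       (auto simp: T_def partial_deriv_outside[OF Cc_infinity_partial_deriv[OF \<phi>]])
  \<comment> \<open>\<open>conj_index\<close> is an involution of \<open>D\<close>, so reindexing by
    it shows that the sum equals its own negative.\<close>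
  moreover have "sum T D = (\<Sum>k\<in>D. T (conj_index k))"
    by (rule sum.reindex_bij_witness[of _ conj_index conj_index]) (auto simp: D_def)
  moreover have "(\<Sum>k\<in>D. T (conj_index k)) = - sum T D"
    unfolding sum_negf[symmetric] by (intro sum.cong) (auto simp: D_def T)
  ultimately show ?thesis by (simp add: T_def)
qed

text \<open>Integrability of both sides belongs to the conclusion: a divergent integral has value 0,
  so the equation alone would not say that the expectations exist.\<close>

theorem proposition3p7:
  fixes M :: "'a measure"
    and W :: "'h::{real_inner, polish_space} \<Rightarrow> 'a \<Rightarrow> real"
    and e :: "nat \<Rightarrow> 'h" and \<alpha> :: "nat \<Rightarrow> real" and J :: "'h \<Rightarrow> 'h"
    and X :: "'a \<Rightarrow> 'h \<Rightarrow> real"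
    and F G :: "'a \<Rightarrow> real" and DF DG :: "'a \<Rightarrow> 'h"
  assumes "gaussian_space M W"
    and "orthonormal_basis e"
    and "symplectic_operator e J"
    and "admissible_weights \<alpha>"
    and "is_vector_field M W e \<alpha> J X"
    and "F \<in> Cc_cyl M W e" and "G \<in> Cc_cyl M W e"
    and "is_gradient M W e F DF" and "is_gradient M W e G DG"
  shows "integrable M (poisson_bracket J DF DG) \<and>
    integrable M (\<lambda>\<omega>. X \<omega> (DF \<omega>) * G \<omega>) \<and>
    (\<integral>\<omega>. poisson_bracket J DF DG \<omega> \<partial>M) = (\<integral>\<omega>. X \<omega> (DF \<omega>) * G \<omega> \<partial>M)"
proof -
  interpret gaussian_space M W by fact
  interpret weighted_basis e \<alpha>
    using assms(2,4) by unfold_locales (auto simp: orthonormal_basis_def admissible_weights_def)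
  note J = \<open>symplectic_operator e J\<close> and X = \<open>is_vector_field M W e \<alpha> J X\<close>
  define V where "V \<omega> = (\<lambda>i. W (e i) \<omega>)" for \<omega>
  obtain n \<phi> where \<phi>: "\<phi> \<in> Cc_infinity n"
    and DF: "\<And>\<omega>. \<omega> \<in> space M \<Longrightarrow> DF \<omega> = (\<Sum>k=1..n. partial_deriv k \<phi> (V \<omega>) *\<^sub>R e k)"
    using \<open>is_gradient M W e F DF\<close> unfolding is_gradient_def cyl_rep_def V_def by blast
  \<comment> \<open>The representation of \<open>G\<close> is taken from its gradient, so that one
    \<psi> describes both \<open>G\<close> and \<open>DG\<close>.\<close>
  obtain m \<psi> where \<psi>: "\<psi> \<in> Cc_infinity m" and G: "\<And>\<omega>. \<omega> \<in> space M \<Longrightarrow> G \<omega> = \<psi> (V \<omega>)"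
    and DG: "\<And>\<omega>. \<omega> \<in> space M \<Longrightarrow> DG \<omega> = (\<Sum>l=1..m. partial_deriv l \<psi> (V \<omega>) *\<^sub>R e l)"
    using \<open>is_gradient M W e G DG\<close> unfolding is_gradient_def cyl_rep_def V_def by blast
  note d\<phi> = Cc_infinity_partial_deriv[OF \<phi>] and d\<psi> = Cc_infinity_partial_deriv[OF \<psi>]
  have linJ: "linear J" using J by (simp add: symplectic_operator_def bounded_linear.linear)
  have bracket: "poisson_bracket J DF DG \<omega> =
      (\<Sum>k=1..n. conj_sign k * (partial_deriv k \<phi> (V \<omega>) * partial_deriv (conj_index k) \<psi> (V \<omega>)))"
    if "\<omega> \<in> space M" for \<omega>
  proof -
    have ek: "e k \<bullet> J (DG \<omega>) = conj_sign k * partial_deriv (conj_index k) \<psi> (V \<omega>)" if k: "k \<ge> 1" for k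
    proof -
      have "e k \<bullet> J (DG \<omega>) = (\<Sum>l=1..m. partial_deriv l \<psi> (V \<omega>) * (e k \<bullet> J (e l)))"
        unfolding DG[OF \<open>\<omega> \<in> space M\<close>] by (simp add: linear_sum[OF linJ] linear_scale[OF linJ] inner_sum_right)
      also have "\<dots> = (\<Sum>l=1..m. if l = conj_index k then conj_sign k * partial_deriv (conj_index k) \<psi> (V \<omega>) else 0)"
      proof (rule sum.cong[OF refl])
        fix l assume "l \<in> {1..m}"
        then have l: "l \<ge> 1" by simp
        show "partial_deriv l \<psi> (V \<omega>) * (e k \<bullet> J (e l)) =
            (if l = conj_index k then conj_sign k * partial_deriv (conj_index k) \<psi> (V \<omega>) else 0)"
          unfolding symplectic_operator_basis[OF J l] inner_scaleR_right
          using orthonormal[OF k conj_index_pos[OF l]] conj_index_eq_iff[OF l k] by auto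
      qed
      also have "\<dots> = (if conj_index k \<in> {1..m} then conj_sign k * partial_deriv (conj_index k) \<psi> (V \<omega>) else 0)"
        by simp
      \<comment> \<open>The derivative of \<psi> vanishes beyond \<open>m\<close>, which removes the
        case distinction and leaves a sum over \<open>{1..n}\<close> whatever \<open>m\<close>
        is.\<close>
      also have "\<dots> = conj_sign k * partial_deriv (conj_index k) \<psi> (V \<omega>)"
        using partial_deriv_outside[OF \<psi>] by (auto split: if_splits)
      finally show ?thesis .
    qed
    show ?thesis
      unfolding poisson_bracket_def DF[OF that] inner_sum_left inner_scaleR_left
      by (intro sum.cong refl) (simp add: ek)
  qed
  \<comment> \<open>Only finitely many coordinates are paired with \<open>DF\<close>, so one null
    set serves them all.\<close>
  have "AE \<omega> in M. \<forall>k\<in>{1..n}. X \<omega> (e k) = conj_sign k * W (e (conj_index k)) \<omega>"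
    using vector_field_coordinate[OF X J] by (intro AE_finite_allI) auto
  then have pairing: "AE \<omega> in M. X \<omega> (DF \<omega>) * G \<omega> =
      (\<Sum>k=1..n. conj_sign k * (W (e (conj_index k)) \<omega> * (partial_deriv k \<phi> (V \<omega>) * \<psi> (V \<omega>))))"
    using AE_space
  proof eventually_elim
    case (elim \<omega>)
    have "X \<omega> (DF \<omega>) = (\<Sum>k=1..n. partial_deriv k \<phi> (V \<omega>) * X \<omega> (e k))"
      unfolding DF[OF elim(2)]
      by (rule Hminus_finite_sum[OF vector_field_values[OF X elim(2)]]) auto
    then show ?case
      unfolding G[OF elim(2)] \<open>X \<omega> (DF \<omega>) = _\<close> sum_distrib_right using elim(1)
      by (intro sum.cong refl) (simp add: mult_ac)
  qed
  \<comment> \<open>Measurability comes from the identity that expands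
    \<open>X \<omega> (DF \<omega>)\<close> at every \<omega> in the space; the formula
    \<open>pairing\<close> holds only almost everywhere.\<close>
  have meas: "(\<lambda>\<omega>. X \<omega> (DF \<omega>) * G \<omega>) \<in> borel_measurable M"
  proof -
    have [measurable]: "(\<lambda>\<omega>. X \<omega> (e k)) \<in> borel_measurable M" if "k \<in> {1..n}" for k
      using vector_field_coordinate_measurable[OF X] that by simp
    have [measurable]: "(\<lambda>\<omega>. partial_deriv k \<phi> (V \<omega>)) \<in> borel_measurable M"
      "(\<lambda>\<omega>. \<psi> (V \<omega>)) \<in> borel_measurable M" for k
      unfolding V_def
      by (intro continuous_W_measurable Cc_infinity_continuous[OF \<psi>] Cc_infinity_continuous[OF d\<phi>])+
    have "(\<lambda>\<omega>. X \<omega> (DF \<omega>) * G \<omega>) \<in> borel_measurable M \<longleftrightarrow>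
        (\<lambda>\<omega>. (\<Sum>k=1..n. partial_deriv k \<phi> (V \<omega>) * X \<omega> (e k)) * \<psi> (V \<omega>)) \<in> borel_measurable M"
      by (intro measurable_cong)
         (simp add: DF G Hminus_finite_sum[OF vector_field_values[OF X]] subset_iff)
    also have "\<dots>" by measurable
    finally show ?thesis .
  qed
  let ?b = "\<lambda>\<omega>. \<Sum>k=1..n. conj_sign k * (partial_deriv k \<phi> (V \<omega>) * partial_deriv (conj_index k) \<psi> (V \<omega>))"
  let ?c = "\<lambda>\<omega>. \<Sum>k=1..n. conj_sign k * (W (e (conj_index k)) \<omega> * (partial_deriv k \<phi> (V \<omega>) * \<psi> (V \<omega>)))"
  let ?r = "\<lambda>\<omega>. \<Sum>k=1..n. conj_sign k * (partial_deriv (conj_index k) (partial_deriv k \<phi>) (V \<omega>) * \<psi> (V \<omega>))"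
  have int: "integrable M (\<lambda>\<omega>. partial_deriv k \<phi> (V \<omega>) * partial_deriv l \<psi> (V \<omega>))"
    "integrable M (\<lambda>\<omega>. W g \<omega> * (partial_deriv k \<phi> (V \<omega>) * \<psi> (V \<omega>)))"
    "integrable M (\<lambda>\<omega>. partial_deriv l (partial_deriv k \<phi>) (V \<omega>) * \<psi> (V \<omega>))" for k l g
    unfolding V_def
    by (rule Cc_infinity_mult_integrable(1)[OF d\<phi> d\<psi>] Cc_infinity_mult_integrable(2)[OF d\<phi> \<psi>]
        Cc_infinity_mult_integrable(1)[OF Cc_infinity_partial_deriv[OF d\<phi>] \<psi>])+
  have ib: "integrable M ?b" and ic: "integrable M ?c"
    by (intro Bochner_Integration.integrable_sum integrable_mult_right int)+
  have "(\<integral>\<omega>. ?c \<omega> \<partial>M) =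
      (\<Sum>k=1..n. conj_sign k * (\<integral>\<omega>. W (e (conj_index k)) \<omega> * (partial_deriv k \<phi> (V \<omega>) * \<psi> (V \<omega>)) \<partial>M))"
    by (simp add: int)
  \<comment> \<open>Integration by parts in direction \<open>conj_index k\<close>, with the k-th
    derivative of \<phi> as the first factor. The second-derivative terms collect in
    \<open>?r\<close>, which vanishes pointwise and not only in expectation.\<close>
  also have "\<dots> = (\<Sum>k=1..n. conj_sign k *
      ((\<integral>\<omega>. partial_deriv (conj_index k) (partial_deriv k \<phi>) (V \<omega>) * \<psi> (V \<omega>) \<partial>M) +
       (\<integral>\<omega>. partial_deriv k \<phi> (V \<omega>) * partial_deriv (conj_index k) \<psi> (V \<omega>) \<partial>M)))"
    unfolding V_def
    by (intro sum.cong refl arg_cong2[where f="(*)"]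
        Cc_infinity_integration_by_parts[OF orthonormal d\<phi> \<psi> conj_index_pos]) auto
  also have "\<dots> = (\<integral>\<omega>. ?r \<omega> \<partial>M) + (\<integral>\<omega>. ?b \<omega> \<partial>M)"
    by (simp add: int distrib_left sum.distrib)
  also have "(\<integral>\<omega>. ?r \<omega> \<partial>M) = 0"
  proof -
    have "?r \<omega> = 0" for \<omega>
      using sum_conj_derivatives_zero[OF \<phi>, of "V \<omega>"]
      by (simp only: mult.assoc[symmetric] sum_distrib_right[symmetric])
    then show ?thesis by simp
  qed
  finally have main: "(\<integral>\<omega>. ?c \<omega> \<partial>M) = (\<integral>\<omega>. ?b \<omega> \<partial>M)" by simp
  have "integrable M (poisson_bracket J DF DG)"
    using ib by (subst Bochner_Integration.integrable_cong[OF refl bracket])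
  moreover have "integrable M (\<lambda>\<omega>. X \<omega> (DF \<omega>) * G \<omega>)"
    by (rule integrable_cong_AE_imp[OF ic meas]) (use pairing in eventually_elim, simp)
  moreover have "(\<integral>\<omega>. poisson_bracket J DF DG \<omega> \<partial>M) = (\<integral>\<omega>. ?b \<omega> \<partial>M)"
    by (rule Bochner_Integration.integral_cong[OF refl bracket])
  moreover have "(\<integral>\<omega>. X \<omega> (DF \<omega>) * G \<omega> \<partial>M) = (\<integral>\<omega>. ?c \<omega> \<partial>M)"
    by (rule integral_cong_AE[OF meas borel_measurable_integrable[OF ic] pairing])
  ultimately show ?thesis using main by simp
qed

end
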